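(* Let $n\ge 1$ and let $a_1,\ldots,a_n,b_1,\ldots,b_n\in\mathbb{Z}_+$. Let $A=[a_1,\ldots,a_n]$ and $B=[b_1,\ldots,b_n]$ be the corresponding multisets. Then the following are equivalent: 1. There exists a regular sequence of homogeneous elements $f_1,\ldots,f_n$ (of maximal length $n$) with $\deg(f_i)=a_i$ for all $i$ in the graded polynomial ring $\mathbb{C}[x_1,\ldots,x_n]$ with $\deg(x_i)=b_i$. (In other words, there exists an empty weighted complete intersection $X_{a_1,\ldots,a_n}\subset\mathbb{P}(b_1,\ldots,b_n)$.) 2. For every subset of indices $I\subseteq\{1,\ldots,n\}$, the inequality $$\#\bigl(A\,\overline{\cap}\,\langle \mathrm{set}(B_I)\rangle_{\mathrm{semigroup}}\bigr)\ \ge\ \# I$$ holds.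
   Context: $\mathbb{Z}_+$ and $\mathbb{Z}_{\ge 0}$ denote the positive and the non-negative integers. Square brackets denote multisets. For a multiset $S$, $\mathrm{set}(S)$ is its underlying set and $\#S$ its cardinality counted with multiplicity. For an indexed multiset $S=[s_1,\ldots,s_n]$ and $I\subseteq\{1,\ldots,n\}$, $S_I:=[s_i : i\in I]$. For a multiset $S$ and a set $S'$, $S\,\overline{\cap}\,S':=[s\in S: s\in S']$ (elements of $S$, kept with their multiplicity in $S$, that lie in $S'$). For a finite set $S=\{s_1,\ldots,s_r\}\subset\mathbb{Z}_+$, $\langle S\rangle_{\mathrm{semigroup}}:=\{c_1s_1+\cdots+c_rs_r : c_i\in\mathbb{Z}_{\ge 0}\}$ (so $\langle\emptyset\rangle_{\mathrm{semigroup}}=\{0\}$). Non-zero homogeneous polynomials $f_1,\ldots,f_m$ in $R=\mathbb{C}[x_1,\ldots,x_n]$ (with respect to the grading $\deg(x_i)=b_i$) form a regular sequence if $f_i$ is not a zero-divisor in $R/(f_1,\ldots,f_{i-1})$ for all $i=1,\ldots,m$. Weighted projective space is $\mathbb{P}(b_1,\ldots,b_n)=\mathrm{Proj}\,\mathbb{C}[x_1,\ldots,x_n]$ with $\deg(x_i)=b_i$, and a weighted complete intersection $X_{a_1,\ldots,a_m}\subset\mathbb{P}(b_1,\ldots,b_n)$ is the vanishing set $V(f_1,\ldots,f_m)=\mathrm{Proj}\,\mathbb{C}[x_1,\ldots,x_n]/(f_1,\ldots,f_m)$ of a regular sequence of homogeneous elements with $\deg(f_i)=a_i$; it is empty when $m=n$.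 *)

theory Defs
  imports
    Complex_Main
    "HOL-Library.Multiset"
    "HOL-Library.Poly_Mapping"
    "HOL-Algebra.QuotRing"
begin

text \<open>
  A polynomial is a finitely supported map from exponent vectors to coefficients, where an
  exponent vector is itself a finitely supported map from variable indices to exponents.
  The product of \<open>Poly_Mapping\<close> is convolution, i.e. multiplication of polynomials.
\<close>

type_synonym mpoly = "(nat \<Rightarrow>\<^sub>0 nat) \<Rightarrow>\<^sub>0 complex"

text \<open>The polynomial ring \<open>\<complex>[x\<^sub>1,\<dots>,x\<^sub>n]\<close>; the variables are indexed from 1.\<close>

definition mpoly_ring :: "nat \<Rightarrow> mpoly ring" where
  "mpoly_ring n =
     \<lparr>carrier = {p. \<forall>m\<in>Poly_Mapping.keys p. Poly_Mapping.keys m \<subseteq> {1..n}},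
      mult = (*), one = 1, zero = 0, add = (+)\<rparr>"

lemma cring_mpoly_ring: "cring (mpoly_ring n)"
proof (rule cringI)
  let ?C = "carrier (mpoly_ring n)"
  have C: "p \<in> ?C \<longleftrightarrow> (\<forall>m\<in>Poly_Mapping.keys p. Poly_Mapping.keys m \<subseteq> {1..n})" for p
    by (simp add: mpoly_ring_def)
  have plus: "p + q \<in> ?C" if "p \<in> ?C" "q \<in> ?C" for p q
    using that keys_add[of p q] unfolding C by blast
  have times: "p * q \<in> ?C" if p: "p \<in> ?C" and q: "q \<in> ?C" for p q
    unfolding C
  proof
    fix m assume "m \<in> Poly_Mapping.keys (p * q)"
    then obtain s t where "s \<in> Poly_Mapping.keys p" "t \<in> Poly_Mapping.keys q" "m = s + t"
      using keys_mult[of p q] by blast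
    then show "Poly_Mapping.keys m \<subseteq> {1..n}"
      using p q keys_add[of s t] unfolding C by blast
  qed
  have uminus: "- p \<in> ?C" if "p \<in> ?C" for p
    using that unfolding C by (auto simp: in_keys_iff)
  have [simp]: "\<zero>\<^bsub>mpoly_ring n\<^esub> = 0" "\<one>\<^bsub>mpoly_ring n\<^esub> = 1"
    "x \<oplus>\<^bsub>mpoly_ring n\<^esub> y = x + y" "x \<otimes>\<^bsub>mpoly_ring n\<^esub> y = x * y" for x y
    by (simp_all add: mpoly_ring_def)
  have zero: "0 \<in> ?C" and one: "1 \<in> ?C"
    unfolding C by simp_all
  show "abelian_group (mpoly_ring n)"
  proof (rule abelian_groupI)
    show "\<exists>y\<in>?C. y \<oplus>\<^bsub>mpoly_ring n\<^esub> x = \<zero>\<^bsub>mpoly_ring n\<^esub>" if "x \<in> ?C" for x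
      using uminus[OF that] by (intro bexI[of _ "- x"]) simp_all
  qed (simp_all add: plus zero add.assoc add.commute)
  show "Group.comm_monoid (mpoly_ring n)"
    by (rule comm_monoidI) (simp_all add: times one mult.assoc mult.commute)
  show "(x \<oplus>\<^bsub>mpoly_ring n\<^esub> y) \<otimes>\<^bsub>mpoly_ring n\<^esub> z =
      x \<otimes>\<^bsub>mpoly_ring n\<^esub> z \<oplus>\<^bsub>mpoly_ring n\<^esub> y \<otimes>\<^bsub>mpoly_ring n\<^esub> z" for x y z
    by (simp add: distrib_right)
qed

definition monomial_degree :: "(nat \<Rightarrow> nat) \<Rightarrow> (nat \<Rightarrow>\<^sub>0 nat) \<Rightarrow> nat" where
  "monomial_degree b m = (\<Sum>i\<in>Poly_Mapping.keys m. Poly_Mapping.lookup m i * b i)"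

text \<open>
  Non-zero homogeneous elements \<open>p\<close> of \<open>\<complex>[x\<^sub>1,\<dots>,x\<^sub>n]\<close> with \<open>deg p = d\<close>, for the grading
  \<open>deg x\<^sub>i = b i\<close>. The zero polynomial has no degree and is excluded.
\<close>

definition homogeneous_of_degree :: "nat \<Rightarrow> (nat \<Rightarrow> nat) \<Rightarrow> nat \<Rightarrow> mpoly \<Rightarrow> bool" where
  "homogeneous_of_degree n b d p \<longleftrightarrow>
     p \<in> carrier (mpoly_ring n) \<and> p \<noteq> 0 \<and>
     (\<forall>m\<in>Poly_Mapping.keys p. monomial_degree b m = d)"

definition zero_divisor :: "('a, 'b) ring_scheme \<Rightarrow> 'a \<Rightarrow> bool" where
  "zero_divisor S x \<longleftrightarrow>
     x \<in> carrier S \<and> (\<exists>y\<in>carrier S. y \<noteq> \<zero>\<^bsub>S\<^esub> \<and> x \<otimes>\<^bsub>S\<^esub> y = \<zero>\<^bsub>S\<^esub>)"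

text \<open>
  The sequence \<open>f 1, \<dots>, f m\<close>; the coset \<open>J +>\<^bsub>R\<^esub> f i\<close> is the residue class of \<open>f i\<close> modulo
  \<open>J = (f 1, \<dots>, f (i - 1))\<close>.
\<close>

definition regular_sequence :: "('a, 'b) ring_scheme \<Rightarrow> nat \<Rightarrow> (nat \<Rightarrow> 'a) \<Rightarrow> bool" where
  "regular_sequence R m f \<longleftrightarrow>
     (\<forall>i\<in>{1..m}. f i \<in> carrier R) \<and>
     (\<forall>i\<in>{1..m}. let J = Idl\<^bsub>R\<^esub> (f ` {1..<i}) in \<not> zero_divisor (R Quot J) (J +>\<^bsub>R\<^esub> f i))"

text \<open>The multiset \<open>S\<^sub>I = [s\<^sub>i : i \<in> I]\<close>, for a finite index set \<open>I\<close>.\<close>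

definition indexed_mset :: "(nat \<Rightarrow> 'a) \<Rightarrow> nat set \<Rightarrow> 'a multiset" where
  "indexed_mset s I = image_mset s (mset_set I)"

definition mset_inter_set :: "'a multiset \<Rightarrow> 'a set \<Rightarrow> 'a multiset" where
  "mset_inter_set S T = filter_mset (\<lambda>s. s \<in> T) S"

definition semigroup_gen :: "nat set \<Rightarrow> nat set" where
  "semigroup_gen S = {\<Sum>s\<in>S. c s * s | c :: nat \<Rightarrow> nat. True}"

end

theory Submission
  imports
    Defs
    "HOL-Computational_Algebra.Fundamental_Theorem_Algebra"
    "HOL-Analysis.Continuum_Not_Denumerable"
begin

text \<open>
  Write \<open>R = \<complex>[x\<^sub>1,\<dots>,x\<^sub>n]\<close> and let \<open>H\<^sub>J(t) = \<Sum>\<^sub>d dim (R/J)\<^sub>d t\<^sup>d\<close> be the Hilbert series of a graded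
  ideal \<open>J\<close>, a convergent series for real \<open>0 < t < 1\<close>. Everything rests on one count
  (\<open>hilbert_series_ideal_insert_ge\<close>, \<open>hilbert_series_ideal_insert_eq_iff\<close>): adding a form \<open>g\<close> of
  degree \<open>e\<close> to \<open>J\<close> multiplies the series by at least \<open>1 - t\<^sup>e\<close>, with equality at a single \<open>t\<close> if
  and only if \<open>g\<close> is a non-zero-divisor modulo \<open>J\<close>. Hence forms of positive degrees
  \<open>e\<^sub>1,\<dots>,e\<^sub>m\<close> generate an ideal whose series is at least \<open>(1 - t\<^bsup>e\<^sub>1\<^esup>)\<cdots>(1 - t\<^bsup>e\<^sub>m\<^esup>) H\<^sub>R(t)\<close>, and they
  form a regular sequence if and only if equality holds, a condition on the unordered family.

  Necessity of the inequalities. Let \<open>f\<^sub>1,\<dots>,f\<^sub>n\<close> be regular, let \<open>I\<close> be a set of indices, and let \<open>K\<close>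
  be the set of those \<open>i\<close> with \<open>a\<^sub>i\<close> in the semigroup of \<open>B\<^sub>I\<close>. If \<open>i \<notin> K\<close>, then each monomial of
  \<open>f\<^sub>i\<close> contains a variable outside \<open>I\<close>, so the ideal of the \<open>f\<^sub>i\<close> lies in the one generated by the
  \<open>f\<^sub>i\<close> with \<open>i \<in> K\<close> and the \<open>x\<^sub>j\<close> with \<open>j \<notin> I\<close>. Comparing the exact series of the former with
  the lower bound for the latter as \<open>t\<close> tends to 1 gives \<open>n - #K \<le> n - #I\<close>
  (\<open>card_bound_of_regular_sequence\<close>).

  Sufficiency. Regularity of \<open>x\<^sub>1,\<dots>,x\<^sub>n\<close> is transported to the wanted sequence by exchanging one
  form at a time: if \<open>L, g\<close> is regular and a power of \<open>g\<close> lies in the ideal of \<open>L, f\<close>, then \<open>L, f\<close>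
  is regular, because \<open>f\<close> divides a power of a non-zero-divisor modulo \<open>L\<close>
  (\<open>has_ci_series_exchange\<close>). This step takes the place of the Cohen-Macaulay property. Choose forms
  \<open>f\<^sub>1,\<dots>,f\<^sub>n\<close> of degrees \<open>a\<^sub>i\<close> and \<open>h\<^sub>1,\<dots>,h\<^sub>n\<close> of degree \<open>b\<^sub>1\<cdots>b\<^sub>n\<close>, a degree that lies in the
  semigroup of every nonempty \<open>B\<^sub>I\<close>, and slide a window of length \<open>n\<close> along
  \<open>f\<^sub>1,\<dots>,f\<^sub>n,h\<^sub>1,\<dots>,h\<^sub>n,x\<^sub>1,\<dots>,x\<^sub>n\<close> from the right end to the left end. If every window has the
  origin as its only common zero, then each exchange is legitimate: by a graded Nullstellensatz
  (\<open>power_in_graded_ideal\<close>) a form of positive degree has a power in the ideal of the window.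

  That the windows have no common zero but the origin is where the inequalities enter, through
  \<open>exists_general_forms\<close>: the forms can be chosen so that a point with support \<open>I\<close> is a zero of
  fewer than \<open>#I\<close> of those whose degree lies in the semigroup of \<open>B\<^sub>I\<close>. The coefficients are
  exponentials of numbers \<open>v\<close> of widely different size. At a zero of a form two of its terms have
  comparable absolute value, which is an approximate linear equation between the logarithms of the
  coordinates and two of the numbers \<open>v\<close>; with \<open>#I\<close> such equations the logarithms can be eliminated,
  since the exponent differences are orthogonal to the weights, and the remaining approximate linear
  relation between the \<open>v\<close> is excluded by their choice.
\<close>

section \<open>The polynomial ring and its ideals\<close>

abbreviation polys :: "nat \<Rightarrow> mpoly set" where
  "polys n \<equiv> carrier (mpoly_ring n)"

abbreviation cst :: "complex \<Rightarrow> mpoly" where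
  "cst c \<equiv> Poly_Mapping.single 0 c"

definition var :: "nat \<Rightarrow> mpoly" where
  "var i = Poly_Mapping.single (Poly_Mapping.single i 1) 1"

lemma polys_iff: "p \<in> polys n \<longleftrightarrow> (\<forall>m\<in>Poly_Mapping.keys p. Poly_Mapping.keys m \<subseteq> {1..n})"
  by (simp add: mpoly_ring_def)

lemma mpoly_ring_simps [simp]:
  "\<zero>\<^bsub>mpoly_ring n\<^esub> = 0" "\<one>\<^bsub>mpoly_ring n\<^esub> = 1"
  "x \<oplus>\<^bsub>mpoly_ring n\<^esub> y = x + y" "x \<otimes>\<^bsub>mpoly_ring n\<^esub> y = x * y"
  by (simp_all add: mpoly_ring_def)

lemma polys_zero [simp]: "0 \<in> polys n" and polys_one [simp]: "1 \<in> polys n"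
  and polys_cst [simp]: "cst c \<in> polys n"
  by (auto simp: polys_iff)

lemma polys_var [simp]: "i \<in> {1..n} \<Longrightarrow> var i \<in> polys n"
  by (auto simp: polys_iff var_def)

lemma polys_add [simp]: "p \<in> polys n \<Longrightarrow> q \<in> polys n \<Longrightarrow> p + q \<in> polys n"
  using cring.cring_simprules(1)[OF cring_mpoly_ring[of n], of p q] by simp

lemma polys_mult [simp]: "p \<in> polys n \<Longrightarrow> q \<in> polys n \<Longrightarrow> p * q \<in> polys n"
  using cring.cring_simprules(5)[OF cring_mpoly_ring[of n], of p q] by simp

lemma polys_uminus [simp]: "p \<in> polys n \<Longrightarrow> - p \<in> polys n"
  by (auto simp: polys_iff in_keys_iff)

lemma polys_diff [simp]: "p \<in> polys n \<Longrightarrow> q \<in> polys n \<Longrightarrow> p - q \<in> polys n"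
  using polys_add[of p n "- q"] by simp

lemma polys_sum [simp]: "(\<And>i. i \<in> A \<Longrightarrow> f i \<in> polys n) \<Longrightarrow> sum f A \<in> polys n"
  by (induction A rule: infinite_finite_induct) auto

lemma polys_prod [simp]: "(\<And>i. i \<in> A \<Longrightarrow> f i \<in> polys n) \<Longrightarrow> prod f A \<in> polys n"
  by (induction A rule: infinite_finite_induct) auto

lemma polys_power [simp]: "p \<in> polys n \<Longrightarrow> p ^ k \<in> polys n"
  by (induction k) auto

lemma ideal_mpoly_ringI:
  assumes "J \<subseteq> polys n" "0 \<in> J" "\<And>p q. p \<in> J \<Longrightarrow> q \<in> J \<Longrightarrow> p + q \<in> J"
    and "\<And>p r. p \<in> J \<Longrightarrow> r \<in> polys n \<Longrightarrow> r * p \<in> J"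
  shows "ideal J (mpoly_ring n)"
proof -
  interpret R: cring "mpoly_ring n" by (rule cring_mpoly_ring)
  have um: "- p \<in> J" if "p \<in> J" for p
    using assms(4)[OF that, of "cst (-1)"] by (simp add: single_uminus)
  have inv: "\<ominus>\<^bsub>mpoly_ring n\<^esub> p = - p" if "p \<in> polys n" for p
    using that by (intro R.minus_equality) auto
  show ?thesis
  proof (rule idealI[OF R.ring_axioms])
    show "subgroup J (add_monoid (mpoly_ring n))"
    proof (rule group.subgroupI)
      show "inv\<^bsub>add_monoid (mpoly_ring n)\<^esub> a \<in> J" if "a \<in> J" for a
        using inv[of a] um[OF that] that assms(1) by (auto simp: a_inv_def)
    qed (use assms R.add.is_group in auto)
  qed (use assms in \<open>auto simp: mult.commute\<close>)
qed

context
  fixes J n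
  assumes J: "ideal J (mpoly_ring n)"
begin

interpretation ideal J "mpoly_ring n" by (rule J)

lemma ideal_subset_polys: "p \<in> J \<Longrightarrow> p \<in> polys n"
  using a_subset by blast

lemma ideal_zero: "0 \<in> J"
  using additive_subgroup.zero_closed[OF is_additive_subgroup] by simp

lemma ideal_add: "p \<in> J \<Longrightarrow> q \<in> J \<Longrightarrow> p + q \<in> J"
  using additive_subgroup.a_closed[OF is_additive_subgroup, of p q] by simp

lemma ideal_mult: "p \<in> J \<Longrightarrow> r \<in> polys n \<Longrightarrow> r * p \<in> J"
  using I_l_closed[of p r] by simp

lemma ideal_mult_right: "p \<in> J \<Longrightarrow> r \<in> polys n \<Longrightarrow> p * r \<in> J"
  using I_r_closed[of p r] by simp

lemma ideal_uminus: "p \<in> J \<Longrightarrow> - p \<in> J"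
  using ideal_mult[of p "- 1"] by simp

lemma ideal_diff: "p \<in> J \<Longrightarrow> q \<in> J \<Longrightarrow> p - q \<in> J"
  using ideal_add[of p "- q"] ideal_uminus[of q] by simp

lemma ideal_sum: "(\<And>i. i \<in> A \<Longrightarrow> f i \<in> J) \<Longrightarrow> sum f A \<in> J"
  by (induction A rule: infinite_finite_induct) (auto simp: ideal_zero ideal_add)

end

text \<open>
  The ideal generated by \<open>J\<close> and \<open>g\<close>, for an ideal \<open>J\<close>; the explicit form is what the dimension
  count and the computation of components act on.
\<close>

definition ideal_insert :: "nat \<Rightarrow> mpoly \<Rightarrow> mpoly set \<Rightarrow> mpoly set" where
  "ideal_insert n g J = {p + q * g | p q. p \<in> J \<and> q \<in> polys n}"

lemma ideal_insertI: "p \<in> J \<Longrightarrow> q \<in> polys n \<Longrightarrow> p + q * g \<in> ideal_insert n g J"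
  by (auto simp: ideal_insert_def)

lemma ideal_ideal_insert:
  assumes "ideal J (mpoly_ring n)" "g \<in> polys n"
  shows "ideal (ideal_insert n g J) (mpoly_ring n)"
proof (rule ideal_mpoly_ringI)
  show "ideal_insert n g J \<subseteq> polys n"
    using assms ideal_subset_polys[OF assms(1)] by (auto simp: ideal_insert_def)
  show "0 \<in> ideal_insert n g J"
    using ideal_insertI[OF ideal_zero[OF assms(1)] polys_zero, of g] by simp
  show "p + q \<in> ideal_insert n g J" if "p \<in> ideal_insert n g J" "q \<in> ideal_insert n g J" for p q
  proof -
    from that obtain p1 p2 q1 q2 where *: "p = p1 + p2 * g" "q = q1 + q2 * g"
      "p1 \<in> J" "q1 \<in> J" "p2 \<in> polys n" "q2 \<in> polys n" by (auto simp: ideal_insert_def)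
    have eq: "p + q = (p1 + q1) + (p2 + q2) * g" unfolding * by (simp add: algebra_simps)
    show ?thesis unfolding eq using * ideal_insertI[of "p1 + q1" J "p2 + q2" n g] ideal_add[OF assms(1)]
      by auto
  qed
  show "r * p \<in> ideal_insert n g J" if "p \<in> ideal_insert n g J" "r \<in> polys n" for p r
  proof -
    from that obtain p1 p2 where *: "p = p1 + p2 * g" "p1 \<in> J" "p2 \<in> polys n"
      by (auto simp: ideal_insert_def)
    have eq: "r * p = r * p1 + (r * p2) * g" unfolding * by (simp add: algebra_simps)
    show ?thesis unfolding eq using * that(2) ideal_insertI[of "r * p1" J "r * p2" n g]
        ideal_mult[OF assms(1)] by auto
  qed
qed

lemma ideal_insert_superset: "J \<subseteq> ideal_insert n g J"
  using ideal_insertI[OF _ polys_zero, of _ J g n] by auto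

lemma ideal_insert_self: "ideal J (mpoly_ring n) \<Longrightarrow> g \<in> ideal_insert n g J"
  using ideal_insertI[OF ideal_zero polys_one, of J n g] by simp

lemma ideal_insert_minimal:
  assumes "ideal K (mpoly_ring n)" "J \<subseteq> K" "g \<in> K"
  shows "ideal_insert n g J \<subseteq> K"
  using assms ideal_add[OF assms(1)] ideal_mult[OF assms(1)] by (auto simp: ideal_insert_def)

abbreviation Ideal :: "nat \<Rightarrow> mpoly set \<Rightarrow> mpoly set" where
  "Ideal n X \<equiv> Idl\<^bsub>mpoly_ring n\<^esub> X"

lemma mpoly_ring_ring: "ring (mpoly_ring n)"
  using cring_mpoly_ring[of n] by (rule cring.axioms(1))

lemmas ideal_Ideal = ring.genideal_ideal[OF mpoly_ring_ring]
lemmas Ideal_minimal = ring.genideal_minimal[OF mpoly_ring_ring]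
lemmas Ideal_self = ring.genideal_self[OF mpoly_ring_ring]

lemma Ideal_empty: "Ideal n {} = {0}"
proof -
  have "ideal {0} (mpoly_ring n)"
    by (rule ideal_mpoly_ringI) auto
  then have "Ideal n {} \<subseteq> {0}" by (rule Ideal_minimal) simp
  moreover have "0 \<in> Ideal n {}"
    by (rule ideal_zero, rule ideal_Ideal) simp
  ultimately show ?thesis by blast
qed

lemma Ideal_insert:
  assumes "g \<in> polys n" "X \<subseteq> polys n"
  shows "Ideal n (insert g X) = ideal_insert n g (Ideal n X)"
proof
  have X: "ideal (Ideal n X) (mpoly_ring n)" "ideal (Ideal n (insert g X)) (mpoly_ring n)"
    using assms by (auto intro!: ideal_Ideal)
  show "Ideal n (insert g X) \<subseteq> ideal_insert n g (Ideal n X)"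
    by (rule Ideal_minimal)
      (use X assms ideal_ideal_insert ideal_insert_self ideal_insert_superset Ideal_self in blast)+
  show "ideal_insert n g (Ideal n X) \<subseteq> Ideal n (insert g X)"
  proof (rule ideal_insert_minimal[OF X(2)])
    show "Ideal n X \<subseteq> Ideal n (insert g X)"
      using X(2) Ideal_self[of "insert g X" n] assms by (intro Ideal_minimal) auto
    show "g \<in> Ideal n (insert g X)"
      using Ideal_self[of "insert g X" n] assms by auto
  qed
qed

lemma mpoly_eq_sum_monomials:
  assumes "finite A" "Poly_Mapping.keys p \<subseteq> A"
  shows "p = (\<Sum>m\<in>A. Poly_Mapping.single m (Poly_Mapping.lookup p m))"
proof (rule poly_mapping_eqI)
  fix k
  have "Poly_Mapping.lookup (\<Sum>m\<in>A. Poly_Mapping.single m (Poly_Mapping.lookup p m)) k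
     = (\<Sum>m\<in>A. if m = k then Poly_Mapping.lookup p m else 0)"
    unfolding lookup_sum by (intro sum.cong) (auto simp: lookup_single when_def)
  also have "\<dots> = Poly_Mapping.lookup p k"
    using assms by (auto simp: in_keys_iff)
  finally show "Poly_Mapping.lookup p k = Poly_Mapping.lookup (\<Sum>m\<in>A. Poly_Mapping.single m (Poly_Mapping.lookup p m)) k"
    by simp
qed

lemma cst_mult_lookup [simp]: "Poly_Mapping.lookup (cst c * p) m = c * Poly_Mapping.lookup p m"
  by (simp flip: mult_map_scale_conv_mult add: map.rep_eq when_def)

section \<open>Common zeros of proper ideals\<close>

text \<open>
  Gaussian elimination: an equation with a non-vanishing coefficient is solved for one unknown and
  substituted into the others.
\<close>

lemma homogeneous_system_solution:
  fixes A :: "'e \<Rightarrow> 'u \<Rightarrow> 'k::field"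
  assumes "finite E" "finite U" "card E < card U"
  shows "\<exists>c. (\<exists>u\<in>U. c u \<noteq> 0) \<and> (\<forall>e\<in>E. (\<Sum>u\<in>U. A e u * c u) = 0)"
  using assms
proof (induction E arbitrary: U A rule: finite_induct)
  case empty
  then obtain u where "u \<in> U" by fastforce
  then show ?case by (intro exI[of _ "\<lambda>_. 1"]) auto
next
  case (insert e E)
  show ?case
  proof (cases "\<forall>u\<in>U. A e u = 0")
    case True
    have "\<exists>c. (\<exists>u\<in>U. c u \<noteq> 0) \<and> (\<forall>e\<in>E. (\<Sum>u\<in>U. A e u * c u) = 0)"
      using insert by (intro insert.IH) auto
    with True show ?thesis by auto
  next
    case False
    then obtain u0 where u0: "u0 \<in> U" "A e u0 \<noteq> 0" by blast
    define A' where "A' = (\<lambda>e' u. A e' u - A e' u0 * A e u / A e u0)"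
    have "\<exists>c. (\<exists>u\<in>U - {u0}. c u \<noteq> 0) \<and> (\<forall>e\<in>E. (\<Sum>u\<in>U - {u0}. A' e u * c u) = 0)"
      using insert u0 by (intro insert.IH) auto
    then obtain c where c: "\<exists>u\<in>U - {u0}. c u \<noteq> 0"
      "\<And>e. e \<in> E \<Longrightarrow> (\<Sum>u\<in>U - {u0}. A' e u * c u) = 0" by blast
    define s where "s = (\<Sum>u\<in>U - {u0}. A e u * c u)"
    define c' where "c' = c(u0 := - s / A e u0)"
    have split: "(\<Sum>u\<in>U. A e' u * c' u) = A e' u0 * (- s / A e u0) + (\<Sum>u\<in>U - {u0}. A e' u * c u)" for e'
      unfolding sum.remove[OF insert.prems(1) u0(1)]
      by (auto simp: c'_def intro!: arg_cong2[where f = plus] sum.cong)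
    have "(\<Sum>u\<in>U. A e' u * c' u) = 0" if e': "e' \<in> E" for e'
    proof -
      have "0 = (\<Sum>u\<in>U - {u0}. A e' u * c u - (A e' u0 / A e u0) * (A e u * c u))"
        using c(2)[OF e'] by (simp add: A'_def algebra_simps)
      also have "\<dots> = (\<Sum>u\<in>U - {u0}. A e' u * c u) - A e' u0 / A e u0 * s"
        by (simp add: sum_subtractf sum_distrib_left s_def)
      finally show ?thesis by (simp add: split)
    qed
    moreover have "(\<Sum>u\<in>U. A e u * c' u) = 0"
      using u0 by (simp add: split s_def[symmetric])
    moreover have "\<exists>u\<in>U. c' u \<noteq> 0" using c(1) by (auto simp: c'_def)
    ultimately show ?thesis by blast
  qed
qed

text \<open>
  The substitution homomorphism from polynomials in one variable, sending the variable to \<open>v\<close>.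
\<close>

definition poly_at :: "mpoly \<Rightarrow> complex poly \<Rightarrow> mpoly" where
  "poly_at v P = poly (map_poly cst P) v"

lemma poly_at_pCons [simp]: "poly_at v (pCons a P) = cst a + v * poly_at v P"
  by (cases "a = 0 \<and> P = 0") (auto simp: poly_at_def map_poly_pCons)

lemma poly_at_0 [simp]: "poly_at v 0 = 0"
  by (simp add: poly_at_def)

lemma poly_at_add [simp]: "poly_at v (P + Q) = poly_at v P + poly_at v Q"
proof (induction P arbitrary: Q)
  case (pCons a P)
  obtain b R where "Q = pCons b R" by (cases Q)
  with pCons(2)[of R] show ?case by (simp add: algebra_simps single_add)
qed auto

lemma poly_at_smult [simp]: "poly_at v (smult c P) = cst c * poly_at v P"
  by (induction P) (auto simp: algebra_simps mult_single)

lemma poly_at_mult [simp]: "poly_at v (P * Q) = poly_at v P * poly_at v Q"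
  by (induction P) (auto simp: algebra_simps)

lemma poly_at_one [simp]: "poly_at v 1 = 1"
  by (simp add: one_pCons)

lemma poly_at_sum: "poly_at v (sum f A) = (\<Sum>a\<in>A. poly_at v (f a))"
  by (induction A rule: infinite_finite_induct) auto

lemma poly_at_prod: "poly_at v (prod f A) = (\<Prod>a\<in>A. poly_at v (f a))"
  by (induction A rule: infinite_finite_induct) auto

lemma polys_poly_at: "v \<in> polys n \<Longrightarrow> poly_at v P \<in> polys n"
  by (induction P) auto

lemma countable_exponents: "countable {m :: nat \<Rightarrow>\<^sub>0 nat. Poly_Mapping.keys m \<subseteq> {1..n}}"
proof (rule countableI')
  show "inj_on (\<lambda>m. to_nat (map (Poly_Mapping.lookup m) [1..<Suc n]))
      {m :: nat \<Rightarrow>\<^sub>0 nat. Poly_Mapping.keys m \<subseteq> {1..n}}"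
  proof (rule inj_onI)
    fix m m' :: "nat \<Rightarrow>\<^sub>0 nat"
    assume *: "m \<in> {m. Poly_Mapping.keys m \<subseteq> {1..n}}" "m' \<in> {m. Poly_Mapping.keys m \<subseteq> {1..n}}"
      and "to_nat (map (Poly_Mapping.lookup m) [1..<Suc n]) = to_nat (map (Poly_Mapping.lookup m') [1..<Suc n])"
    then have "\<forall>i\<in>set [1..<Suc n]. Poly_Mapping.lookup m i = Poly_Mapping.lookup m' i"
      by (simp del: upt_Suc)
    then have "Poly_Mapping.lookup m i = Poly_Mapping.lookup m' i" if "i \<in> {1..n}" for i
      using that by (simp del: upt_Suc)
    moreover have "Poly_Mapping.lookup m i = Poly_Mapping.lookup m' i" if "i \<notin> {1..n}" for i
      using that * by (metis (no_types, lifting) mem_Collect_eq in_keys_iff subset_iff)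
    ultimately show "m = m'" by (intro poly_mapping_eqI) blast
  qed
qed

text \<open>
  Over the complex numbers \<open>P\<close> splits into linear factors, and each factor is a unit modulo \<open>J\<close> by
  assumption; so \<open>P(v)\<close> is a unit in the non-trivial ring \<open>R/J\<close>.
\<close>

lemma poly_at_notin_ideal:
  assumes J: "ideal J (mpoly_ring n)" "1 \<notin> J" and v: "v \<in> polys n"
    and unit: "\<And>c. \<exists>q\<in>polys n. q * (v - cst c) - 1 \<in> J"
    and "P \<noteq> 0"
  shows "poly_at v P \<notin> J"
  using \<open>P \<noteq> 0\<close>
proof (induction "degree P" arbitrary: P)
  case 0
  then obtain a where a: "P = [:a:]" "a \<noteq> 0" by (metis degree_0_id of_real_0 pCons_0_0)
  show ?case
  proof
    assume "poly_at v P \<in> J"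
    then have "cst (1 / a) * cst a \<in> J" using a ideal_mult[OF J(1), of "cst a" "cst (1/a)"] by simp
    then show False using a J(2) by (simp add: mult_single)
  qed
next
  case (Suc k)
  then have "\<not> constant (poly P)" by (metis constant_degree nat.distinct(1))
  then obtain z where "poly P z = 0" using fundamental_theorem_of_algebra by blast
  then obtain Q where Q: "P = [:- z, 1:] * Q" by (metis dvdE poly_eq_0_iff_dvd)
  with Suc have "Q \<noteq> 0" by auto
  then have "degree P = Suc (degree Q)" unfolding Q by (subst degree_mult_eq) auto
  with Suc \<open>Q \<noteq> 0\<close> have notin: "poly_at v Q \<notin> J" by auto
  obtain q where q: "q \<in> polys n" "q * (v - cst z) - 1 \<in> J" using unit by blast
  show ?case
  proof
    assume "poly_at v P \<in> J"
    moreover have "poly_at v P = (v - cst z) * poly_at v Q"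
      unfolding Q poly_at_mult by (simp add: single_uminus)
    ultimately have "q * ((v - cst z) * poly_at v Q) \<in> J"
      using ideal_mult[OF J(1)] q(1) by simp
    moreover have "(q * (v - cst z) - 1) * poly_at v Q \<in> J"
      using ideal_mult_right[OF J(1)] q(2) polys_poly_at[OF v] by blast
    ultimately have "q * ((v - cst z) * poly_at v Q) - (q * (v - cst z) - 1) * poly_at v Q \<in> J"
      by (rule ideal_diff[OF J(1)])
    then show False using notin by (simp add: algebra_simps)
  qed
qed

text \<open>
  Uncountability of the ground field replaces the Noether normalisation that usually proves the
  Nullstellensatz. If \<open>v - c\<close> were a unit modulo \<open>J\<close> for all \<open>c\<close>, there would be uncountably many
  inverses, hence infinitely many supported on one and the same finite set of monomials, hence a
  linear relation among finitely many of them. Clearing denominators turns this relation into a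
  non-zero polynomial in \<open>v\<close> that lies in \<open>J\<close>, contrary to \<open>poly_at_notin_ideal\<close>.
\<close>

lemma exists_proper_ideal_insert_linear:
  assumes J: "ideal J (mpoly_ring n)" "1 \<notin> J" and v: "v \<in> polys n"
  shows "\<exists>c. 1 \<notin> ideal_insert n (v - cst c) J"
proof (rule ccontr)
  assume neg: "\<not> (\<exists>c. 1 \<notin> ideal_insert n (v - cst c) J)"
  have unit: "\<exists>q\<in>polys n. q * (v - cst c) - 1 \<in> J" for c
  proof -
    obtain p q where pq: "1 = p + q * (v - cst c)" "p \<in> J" "q \<in> polys n"
      using neg unfolding ideal_insert_def by blast
    have "q * (v - cst c) - 1 = - p" using pq(1) by (simp add: algebra_simps)
    with ideal_uminus[OF J(1) pq(2)] pq(3) show ?thesis by (intro bexI[of _ q]) simp_all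
  qed
  then obtain q where q: "\<And>c. q c \<in> polys n" "\<And>c. q c * (v - cst c) - 1 \<in> J" by metis
  define K where "K = (\<lambda>r::real. Poly_Mapping.keys (q (complex_of_real r)))"
  define Fin where "Fin = {E. finite E \<and> E \<subseteq> {m :: nat \<Rightarrow>\<^sub>0 nat. Poly_Mapping.keys m \<subseteq> {1..n}}}"
  have "countable Fin"
    unfolding Fin_def
    using countable_Collect_finite_subset[OF countable_exponents] by (simp add: conj_commute)
  have "(UNIV :: real set) \<subseteq> (\<Union>E\<in>Fin. {r. K r = E})"
  proof -
    have "K r \<in> Fin" for r
      using q(1)[of "complex_of_real r"] unfolding Fin_def K_def polys_iff by (intro CollectI conjI finite_keys) blast
    then show ?thesis by blast
  qed
  have "\<exists>E\<in>Fin. infinite {r. K r = E}"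
  proof (rule ccontr)
    assume "\<not> (\<exists>E\<in>Fin. infinite {r. K r = E})"
    then have "countable (\<Union>E\<in>Fin. {r. K r = E})"
      using \<open>countable Fin\<close> by (intro countable_UN) (auto intro: countable_finite)
    then show False
      using \<open>UNIV \<subseteq> _\<close> uncountable_UNIV_real countable_subset by blast
  qed
  then obtain E where E: "finite E" "infinite {r. K r = E}" by (auto simp: Fin_def)
  obtain L where L: "L \<subseteq> {r. K r = E}" "finite L" "card L = Suc (card E)"
    using infinite_arbitrarily_large[OF E(2)] by blast
  obtain c where c: "\<exists>r\<in>L. c r \<noteq> 0"
    "\<forall>m\<in>E. (\<Sum>r\<in>L. Poly_Mapping.lookup (q (complex_of_real r)) m * c r) = 0"
    using homogeneous_system_solution[OF E(1) L(2),
        of "\<lambda>m r. Poly_Mapping.lookup (q (complex_of_real r)) m"] L(3) by auto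
  have dep: "(\<Sum>r\<in>L. cst (c r) * q (complex_of_real r)) = 0"
  proof (rule poly_mapping_eqI)
    fix m
    show "Poly_Mapping.lookup (\<Sum>r\<in>L. cst (c r) * q (complex_of_real r)) m = Poly_Mapping.lookup 0 m"
    proof (cases "m \<in> E")
      case True
      have "Poly_Mapping.lookup (\<Sum>r\<in>L. cst (c r) * q (complex_of_real r)) m
          = (\<Sum>r\<in>L. Poly_Mapping.lookup (q (complex_of_real r)) m * c r)"
        unfolding lookup_sum cst_mult_lookup by (simp add: mult.commute)
      with c(2) True show ?thesis by simp
    next
      case False
      then have "Poly_Mapping.lookup (q (complex_of_real r)) m = 0" if "r \<in> L" for r
        using L(1) that unfolding K_def by (metis (mono_tags, lifting) in_keys_iff mem_Collect_eq subset_iff)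
      then show ?thesis by (simp add: lookup_sum)
    qed
  qed
  \<comment> \<open>Multiplying \<open>\<Sum> c r / (v - r) = 0\<close> by the product of all denominators gives \<open>P(v) = 0\<close> modulo \<open>J\<close>.\<close>
  define P where "P = (\<Sum>r\<in>L. smult (c r) (\<Prod>s\<in>L - {r}. [:- complex_of_real s, 1:]))"
  have "P \<noteq> 0"
  proof -
    \<comment> \<open>At a node \<open>r0\<close> only the summand of \<open>r0\<close> survives.\<close>
    obtain r0 where r0: "r0 \<in> L" "c r0 \<noteq> 0" using c(1) by blast
    have "poly P r0 = (\<Sum>r\<in>L. if r = r0 then c r * (\<Prod>s\<in>L - {r}. complex_of_real r0 - complex_of_real s) else 0)"
      unfolding P_def poly_sum using L(2) r0
      by (intro sum.cong) (auto simp: poly_prod prod_zero_iff)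
    also have "\<dots> = c r0 * (\<Prod>s\<in>L - {r0}. complex_of_real r0 - complex_of_real s)"
      using r0 L(2) by simp
    also have "\<dots> \<noteq> 0" using r0 L(2) by (simp add: prod_zero_iff)
    finally show ?thesis by auto
  qed
  define W where "W = (\<lambda>A. \<Prod>s\<in>A. (v - cst (complex_of_real s)))"
  have W: "W A \<in> polys n" for A unfolding W_def using v by (intro polys_prod) auto
  have at_W: "poly_at v (\<Prod>s\<in>A. [:- complex_of_real s, 1:]) = W A" for A
    by (simp add: poly_at_prod W_def single_uminus)
  have "(\<Sum>r\<in>L. cst (c r) * W (L - {r}) * (q (complex_of_real r) * (v - cst (complex_of_real r)) - 1)) \<in> J"
    using q W by (intro ideal_sum[OF J(1)] ideal_mult[OF J(1)]) auto
  moreover have "(\<Sum>r\<in>L. cst (c r) * W (L - {r}) * (q (complex_of_real r) * (v - cst (complex_of_real r)) - 1)) =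
     (\<Sum>r\<in>L. W L * (cst (c r) * q (complex_of_real r)) - cst (c r) * W (L - {r}))"
  proof (rule sum.cong)
    fix r assume "r \<in> L"
    then have WL: "W L = (v - cst (complex_of_real r)) * W (L - {r})"
      unfolding W_def using L(2) by (simp add: prod.remove)
    show "cst (c r) * W (L - {r}) * (q (complex_of_real r) * (v - cst (complex_of_real r)) - 1)
      = W L * (cst (c r) * q (complex_of_real r)) - cst (c r) * W (L - {r})"
      unfolding WL by (simp add: algebra_simps)
  qed simp
  moreover have "\<dots> = W L * (\<Sum>r\<in>L. cst (c r) * q (complex_of_real r)) - poly_at v P"
    by (simp add: sum_subtractf sum_distrib_left P_def poly_at_sum at_W)
  ultimately have "- poly_at v P \<in> J" by (simp add: dep)
  then have "poly_at v P \<in> J" using ideal_uminus[OF J(1)] by fastforce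
  then show False using poly_at_notin_ideal[OF J v unit \<open>P \<noteq> 0\<close>] by blast
qed

definition eval_monomial :: "(nat \<Rightarrow> complex) \<Rightarrow> (nat \<Rightarrow>\<^sub>0 nat) \<Rightarrow> complex" where
  "eval_monomial x m = (\<Prod>i\<in>Poly_Mapping.keys m. x i ^ Poly_Mapping.lookup m i)"

definition eval_mpoly :: "(nat \<Rightarrow> complex) \<Rightarrow> mpoly \<Rightarrow> complex" where
  "eval_mpoly x p = (\<Sum>m\<in>Poly_Mapping.keys p. Poly_Mapping.lookup p m * eval_monomial x m)"

lemma eval_mpoly_superset:
  assumes "finite A" "Poly_Mapping.keys p \<subseteq> A"
  shows "eval_mpoly x p = (\<Sum>m\<in>A. Poly_Mapping.lookup p m * eval_monomial x m)"
  unfolding eval_mpoly_def using assms by (intro sum.mono_neutral_left) (auto simp: in_keys_iff)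

lemma eval_mpoly_diff: "eval_mpoly x (p - q) = eval_mpoly x p - eval_mpoly x q"
proof -
  let ?A = "Poly_Mapping.keys p \<union> Poly_Mapping.keys q"
  have "Poly_Mapping.keys (p - q) \<subseteq> ?A" by (auto simp: in_keys_iff lookup_minus)
  then have "eval_mpoly x (p - q) = (\<Sum>m\<in>?A. Poly_Mapping.lookup (p - q) m * eval_monomial x m)"
    by (intro eval_mpoly_superset) auto
  also have "\<dots> = eval_mpoly x p - eval_mpoly x q"
    by (simp add: eval_mpoly_superset[of ?A] lookup_minus left_diff_distrib sum_subtractf)
  finally show ?thesis .
qed

lemma eval_mpoly_one [simp]: "eval_mpoly x 1 = 1"
  by (simp add: eval_mpoly_def eval_monomial_def)

lemma eval_mpoly_var [simp]: "eval_mpoly x (var i) = x i"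
  by (simp add: eval_mpoly_def eval_monomial_def var_def)

lemma monomial_eq_prod_vars:
  "Poly_Mapping.single m 1 = (\<Prod>i\<in>Poly_Mapping.keys m. var i ^ Poly_Mapping.lookup m i)"
proof -
  have pow: "Poly_Mapping.single k (1::complex) ^ e = Poly_Mapping.single (of_nat e * k) 1"
    for k :: "nat \<Rightarrow>\<^sub>0 nat" and e
    by (induction e) (auto simp: mult_single algebra_simps)
  have prod: "(\<Prod>i\<in>A. Poly_Mapping.single (f i) (1::complex)) = Poly_Mapping.single (sum f A) 1"
    for A :: "nat set" and f :: "nat \<Rightarrow> nat \<Rightarrow>\<^sub>0 nat"
    by (induction A rule: infinite_finite_induct) (auto simp: mult_single)
  have "m = (\<Sum>i\<in>Poly_Mapping.keys m. of_nat (Poly_Mapping.lookup m i) * Poly_Mapping.single i 1)"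
    (is "_ = ?s")
  proof (rule poly_mapping_eqI)
    fix k
    have "Poly_Mapping.lookup ?s k = (\<Sum>i\<in>Poly_Mapping.keys m. if i = k then Poly_Mapping.lookup m i else 0)"
      unfolding lookup_sum
      by (intro sum.cong) (auto simp: mult_single lookup_single when_def simp flip: single_of_nat)
    then show "Poly_Mapping.lookup m k = Poly_Mapping.lookup ?s k" by (simp add: in_keys_iff)
  qed
  then show ?thesis by (simp add: pow prod var_def)
qed

text \<open>
  The weak Nullstellensatz. The variables are specialised one after another without losing
  properness; modulo the final ideal every polynomial is congruent to its value at the point of
  specialisation, so elements of \<open>J\<close> with a non-zero value there would be units.
\<close>

lemma common_zero_of_proper_ideal:
  assumes J: "ideal J (mpoly_ring n)" "1 \<notin> J"
  shows "\<exists>x. \<forall>p\<in>J. eval_mpoly x p = 0"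
proof -
  have "\<exists>x J'. ideal J' (mpoly_ring n) \<and> 1 \<notin> J' \<and> J \<subseteq> J' \<and> (\<forall>i\<in>{1..k}. var i - cst (x i) \<in> J')"
    if "k \<le> n" for k
    using that
  proof (induction k)
    case 0
    then show ?case using J by (intro exI[of _ undefined] exI[of _ J]) auto
  next
    case (Suc k)
    then obtain x J' where IH: "ideal J' (mpoly_ring n)" "1 \<notin> J'" "J \<subseteq> J'"
      "\<And>i. i \<in> {1..k} \<Longrightarrow> var i - cst (x i) \<in> J'"
      using Suc_leD by blast
    have v: "var (Suc k) \<in> polys n" using Suc.prems by simp
    obtain c where c: "1 \<notin> ideal_insert n (var (Suc k) - cst c) J'"
      using exists_proper_ideal_insert_linear[OF IH(1,2) v] by blast
    let ?J = "ideal_insert n (var (Suc k) - cst c) J'"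
    have "var i - cst ((x(Suc k := c)) i) \<in> ?J" if "i \<in> {1..Suc k}" for i
    proof (cases "i = Suc k")
      case True
      then show ?thesis using ideal_insert_self[OF IH(1)] by simp
    next
      case False
      with that have "var i - cst (x i) \<in> J'" by (intro IH(4)) auto
      with False show ?thesis using ideal_insert_superset by fastforce
    qed
    moreover have "ideal ?J (mpoly_ring n)" using IH(1) v by (intro ideal_ideal_insert) auto
    ultimately show ?case
      using c IH(3) ideal_insert_superset[of J' n]
      by (intro exI[of _ "x(Suc k := c)"] exI[of _ ?J]) blast
  qed
  from this[of n] obtain x J' where J': "ideal J' (mpoly_ring n)" "1 \<notin> J'" "J \<subseteq> J'"
    and var: "\<And>i. i \<in> {1..n} \<Longrightarrow> var i - cst (x i) \<in> J'" by blast
  have mult: "p * q - cst (c * d) \<in> J'"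
    if "p - cst c \<in> J'" "q - cst d \<in> J'" "p \<in> polys n" for p q c d
  proof -
    have "p * (q - cst d) + cst d * (p - cst c) \<in> J'"
      using that by (intro ideal_add[OF J'(1)] ideal_mult[OF J'(1)]) auto
    then show ?thesis by (simp add: algebra_simps mult_single)
  qed
  have power: "p ^ e - cst (c ^ e) \<in> J'" if "p - cst c \<in> J'" "p \<in> polys n" for p c e
    by (induction e) (use that mult ideal_zero[OF J'(1)] in auto)
  have prod: "(\<Prod>i\<in>A. p i) - cst (\<Prod>i\<in>A. c i) \<in> J'"
    if "finite A" "\<And>i. i \<in> A \<Longrightarrow> p i - cst (c i) \<in> J'" "\<And>i. i \<in> A \<Longrightarrow> p i \<in> polys n"
    for A and p :: "nat \<Rightarrow> mpoly" and c
    using that by (induction A rule: finite_induct) (use mult ideal_zero[OF J'(1)] in auto)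
  have monomial: "Poly_Mapping.single m 1 - cst (eval_monomial x m) \<in> J'"
    if "Poly_Mapping.keys m \<subseteq> {1..n}" for m
    unfolding monomial_eq_prod_vars eval_monomial_def using that var
    by (intro prod power polys_power polys_var) auto
  have "p - cst (eval_mpoly x p) \<in> J'" if p: "p \<in> polys n" for p
  proof -
    have "(\<Sum>m\<in>Poly_Mapping.keys p. cst (Poly_Mapping.lookup p m) *
        (Poly_Mapping.single m 1 - cst (eval_monomial x m))) \<in> J'"
      using p by (intro ideal_sum[OF J'(1)] ideal_mult[OF J'(1)] monomial) (auto simp: polys_iff)
    also have "(\<Sum>m\<in>Poly_Mapping.keys p. cst (Poly_Mapping.lookup p m) *
        (Poly_Mapping.single m 1 - cst (eval_monomial x m))) = 
        (\<Sum>m\<in>Poly_Mapping.keys p. Poly_Mapping.single m (Poly_Mapping.lookup p m))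
        - (\<Sum>m\<in>Poly_Mapping.keys p. cst (Poly_Mapping.lookup p m * eval_monomial x m))"
      by (simp add: algebra_simps mult_single sum_subtractf)
    also have "(\<Sum>m\<in>Poly_Mapping.keys p. Poly_Mapping.single m (Poly_Mapping.lookup p m)) = p"
      by (rule mpoly_eq_sum_monomials[symmetric]) auto
    also have "(\<Sum>m\<in>A. cst (g m)) = cst (sum g A)" for A :: "(nat \<Rightarrow>\<^sub>0 nat) set" and g
      by (induction A rule: infinite_finite_induct) (auto simp: single_add)
    finally show ?thesis by (simp add: eval_mpoly_def)
  qed
  note cong = this
  have "eval_mpoly x p = 0" if "p \<in> J" for p
  proof (rule ccontr)
    assume nz: "eval_mpoly x p \<noteq> 0"
    have "p \<in> J'" "p \<in> polys n" using that J'(3) ideal_subset_polys[OF J'(1)] by auto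
    then have "p - (p - cst (eval_mpoly x p)) \<in> J'" using cong ideal_diff[OF J'(1)] by blast
    then have "cst (1 / eval_mpoly x p) * cst (eval_mpoly x p) \<in> J'"
      by (intro ideal_mult[OF J'(1)]) auto
    then show False using nz J'(2) by (simp add: mult_single)
  qed
  then show ?thesis by blast
qed

section \<open>The grading\<close>

lemma monomial_degree_superset:
  assumes "finite A" "Poly_Mapping.keys m \<subseteq> A"
  shows "monomial_degree b m = (\<Sum>i\<in>A. Poly_Mapping.lookup m i * b i)"
  unfolding monomial_degree_def using assms by (intro sum.mono_neutral_left) (auto simp: in_keys_iff)

lemma monomial_degree_add: "monomial_degree b (m + m') = monomial_degree b m + monomial_degree b m'"
proof -
  let ?A = "Poly_Mapping.keys m \<union> Poly_Mapping.keys m'"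
  have "monomial_degree b (m + m') = (\<Sum>i\<in>?A. Poly_Mapping.lookup (m + m') i * b i)"
    using keys_add[of m m'] by (intro monomial_degree_superset) auto
  also have "\<dots> = monomial_degree b m + monomial_degree b m'"
    by (simp add: monomial_degree_superset[of ?A] lookup_add algebra_simps sum.distrib)
  finally show ?thesis .
qed

definition monoms :: "nat \<Rightarrow> (nat \<Rightarrow> nat) \<Rightarrow> nat \<Rightarrow> (nat \<Rightarrow>\<^sub>0 nat) set" where
  "monoms n b d = {m. Poly_Mapping.keys m \<subseteq> {1..n} \<and> monomial_degree b m = d}"

definition forms :: "nat \<Rightarrow> (nat \<Rightarrow> nat) \<Rightarrow> nat \<Rightarrow> mpoly set" where
  "forms n b d = {p. Poly_Mapping.keys p \<subseteq> monoms n b d}"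

lemma homogeneous_of_degree_iff: "homogeneous_of_degree n b d p \<longleftrightarrow> p \<in> forms n b d \<and> p \<noteq> 0"
  by (auto simp: homogeneous_of_degree_def forms_def monoms_def polys_iff)

lemma forms_subset_polys: "p \<in> forms n b d \<Longrightarrow> p \<in> polys n"
  by (auto simp: forms_def monoms_def polys_iff)

lemma forms_zero [simp]: "0 \<in> forms n b d"
  by (simp add: forms_def)

lemma forms_one: "1 \<in> forms n b 0"
  by (auto simp: forms_def monoms_def monomial_degree_def)

lemma forms_var: "i \<in> {1..n} \<Longrightarrow> var i \<in> forms n b (b i)"
  by (auto simp: forms_def monoms_def monomial_degree_def var_def)

lemma forms_add: "p \<in> forms n b d \<Longrightarrow> q \<in> forms n b d \<Longrightarrow> p + q \<in> forms n b d"
  using keys_add[of p q] by (auto simp: forms_def)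

lemma forms_mult:
  assumes "p \<in> forms n b d" "q \<in> forms n b e"
  shows "p * q \<in> forms n b (d + e)"
  unfolding forms_def
proof (intro CollectI subsetI)
  fix m assume "m \<in> Poly_Mapping.keys (p * q)"
  then obtain s t where st: "s \<in> Poly_Mapping.keys p" "t \<in> Poly_Mapping.keys q" "m = s + t"
    using keys_mult[of p q] by blast
  then have "s \<in> monoms n b d" "t \<in> monoms n b e" using assms by (auto simp: forms_def)
  then show "m \<in> monoms n b (d + e)"
    using keys_add[of s t] by (auto simp: monoms_def st(3) monomial_degree_add)
qed

definition component :: "(nat \<Rightarrow> nat) \<Rightarrow> nat \<Rightarrow> mpoly \<Rightarrow> mpoly" where
  "component b d p = (\<Sum>m | m \<in> Poly_Mapping.keys p \<and> monomial_degree b m = d.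
     Poly_Mapping.single m (Poly_Mapping.lookup p m))"

lemma lookup_component:
  "Poly_Mapping.lookup (component b d p) m = (if monomial_degree b m = d then Poly_Mapping.lookup p m else 0)"
proof -
  have "Poly_Mapping.lookup (component b d p) m =
    (\<Sum>k | k \<in> Poly_Mapping.keys p \<and> monomial_degree b k = d. if k = m then Poly_Mapping.lookup p k else 0)"
    unfolding component_def lookup_sum by (intro sum.cong) (auto simp: lookup_single when_def)
  then show ?thesis by (simp add: in_keys_iff)
qed

lemma component_zero [simp]: "component b d 0 = 0"
  by (simp add: component_def)

lemma component_add: "component b d (p + q) = component b d p + component b d q"
  by (rule poly_mapping_eqI) (simp add: lookup_component lookup_add)

lemma component_sum: "component b d (sum f A) = (\<Sum>a\<in>A. component b d (f a))"
  by (induction A rule: infinite_finite_induct) (auto simp: component_add)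

lemma component_in_forms: "p \<in> polys n \<Longrightarrow> component b d p \<in> forms n b d"
  by (auto simp: forms_def monoms_def polys_iff in_keys_iff lookup_component split: if_splits)

lemma component_in_polys [simp]: "p \<in> polys n \<Longrightarrow> component b d p \<in> polys n"
  by (rule forms_subset_polys, rule component_in_forms)

lemma component_of_form:
  assumes "p \<in> forms n b e"
  shows "component b d p = (if d = e then p else 0)"
proof (rule poly_mapping_eqI)
  fix m
  have "Poly_Mapping.lookup p m = 0" if "monomial_degree b m \<noteq> e"
    using assms that by (auto simp: forms_def monoms_def in_keys_iff)
  then show "Poly_Mapping.lookup (component b d p) m = Poly_Mapping.lookup (if d = e then p else 0) m"
    by (auto simp: lookup_component)
qed

lemma sum_components:
  assumes "finite D" "monomial_degree b ` Poly_Mapping.keys p \<subseteq> D"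
  shows "(\<Sum>d\<in>D. component b d p) = p"
proof (rule poly_mapping_eqI)
  fix m
  have "Poly_Mapping.lookup (\<Sum>d\<in>D. component b d p) m
    = (if monomial_degree b m \<in> D then Poly_Mapping.lookup p m else 0)"
    using assms(1) by (simp add: lookup_sum lookup_component)
  also have "\<dots> = Poly_Mapping.lookup p m"
    using assms(2) in_keys_iff[of m p] by (cases "Poly_Mapping.lookup p m = 0") auto
  finally show "Poly_Mapping.lookup (\<Sum>d\<in>D. component b d p) m = Poly_Mapping.lookup p m" .
qed

text \<open>
  The condition \<open>e \<le> d\<close> matters because \<open>d - e\<close> is truncated: below degree \<open>e\<close> the right-hand side
  would otherwise be the degree 0 component of \<open>p\<close> times \<open>g\<close>.
\<close>

lemma component_mult_form:
  assumes "p \<in> polys n" "g \<in> forms n b e"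
  shows "component b d (p * g) = (if e \<le> d then component b (d - e) p * g else 0)"
proof -
  let ?D = "monomial_degree b ` Poly_Mapping.keys p"
  have zero: "component b k p = 0" if "k \<notin> ?D" for k
    by (rule poly_mapping_eqI) (use that in \<open>auto simp: lookup_component in_keys_iff\<close>)
  have "p * g = (\<Sum>k\<in>?D. component b k p * g)"
    by (simp add: sum_components flip: sum_distrib_right)
  then have "component b d (p * g) = (\<Sum>k\<in>?D. component b d (component b k p * g))"
    by (metis component_sum)
  also have "\<dots> = (\<Sum>k\<in>?D. if d = k + e then component b k p * g else 0)"
    using assms by (intro sum.cong component_of_form refl forms_mult component_in_forms)
  also have "\<dots> = (\<Sum>k\<in>?D. if k = d - e then (if e \<le> d then component b k p * g else 0) else 0)"
    by (intro sum.cong) auto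
  also have "\<dots> = (if e \<le> d then component b (d - e) p * g else 0)"
    using zero[of "d - e"] by (cases "d - e \<in> ?D") (simp_all del: image_iff)
  finally show ?thesis .
qed

definition graded_ideal :: "nat \<Rightarrow> (nat \<Rightarrow> nat) \<Rightarrow> mpoly set \<Rightarrow> bool" where
  "graded_ideal n b J \<longleftrightarrow> ideal J (mpoly_ring n) \<and> (\<forall>p\<in>J. \<forall>d. component b d p \<in> J)"

lemma graded_ideal_insert:
  assumes "graded_ideal n b J" "g \<in> forms n b e"
  shows "graded_ideal n b (ideal_insert n g J)"
  unfolding graded_ideal_def
proof (intro conjI ballI allI)
  have J: "ideal J (mpoly_ring n)" using assms(1) by (simp add: graded_ideal_def)
  have g: "g \<in> polys n" using assms(2) by (rule forms_subset_polys)
  show I: "ideal (ideal_insert n g J) (mpoly_ring n)" by (rule ideal_ideal_insert[OF J g])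
  fix r d assume "r \<in> ideal_insert n g J"
  then obtain p q where r: "r = p + q * g" "p \<in> J" "q \<in> polys n" by (auto simp: ideal_insert_def)
  have "component b d r = component b d p + (if e \<le> d then component b (d - e) q else 0) * g"
    by (simp add: r(1) component_add component_mult_form[OF r(3) assms(2)])
  also have "\<dots> \<in> ideal_insert n g J"
    using assms(1) r by (intro ideal_insertI) (auto simp: graded_ideal_def)
  finally show "component b d r \<in> ideal_insert n g J" .
qed

lemma graded_ideal_Ideal:
  assumes "finite S" "\<And>i. i \<in> S \<Longrightarrow> F i \<in> forms n b (d i)"
  shows "graded_ideal n b (Ideal n (F ` S))"
  using assms
proof (induction S rule: finite_induct)
  case empty
  have "ideal {0} (mpoly_ring n)" by (rule ideal_mpoly_ringI) auto
  then show ?case by (simp add: Ideal_empty graded_ideal_def)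
next
  case (insert i S)
  then have "Ideal n (F ` insert i S) = ideal_insert n (F i) (Ideal n (F ` S))"
    unfolding image_insert
    by (intro Ideal_insert) (use insert.prems forms_subset_polys in blast)+
  moreover have "graded_ideal n b (ideal_insert n (F i) (Ideal n (F ` S)))"
    using insert.prems by (intro graded_ideal_insert[where e = "d i"] insert.IH) auto
  ultimately show ?case by simp
qed

text \<open>
  A graded Nullstellensatz. Since \<open>z\<close> cannot take the value 1 on the zero set of \<open>I\<close>, the ideal
  generated by \<open>I\<close> and \<open>z - 1\<close> contains 1. The homogeneous components of an equation
  \<open>1 = p + q (z - 1)\<close> say that \<open>q\<close> is congruent modulo \<open>I\<close>, degree by degree, to the geometric
  series \<open>- 1 - z - z\<^sup>2 - \<dots>\<close>; as \<open>q\<close> has finitely many components, some power of \<open>z\<close> is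
  congruent to 0. In contrast to the trick of Rabinowitsch no variable has to be adjoined.
\<close>

lemma power_in_graded_ideal:
  assumes I: "graded_ideal n b I" and z: "z \<in> forms n b e" "e > 0"
    and vanish: "\<And>x. (\<And>p. p \<in> I \<Longrightarrow> eval_mpoly x p = 0) \<Longrightarrow> eval_mpoly x z = 0"
  shows "\<exists>k. z ^ k \<in> I"
proof -
  have J: "ideal I (mpoly_ring n)" and comp: "\<And>p d. p \<in> I \<Longrightarrow> component b d p \<in> I"
    using I by (auto simp: graded_ideal_def)
  have zp: "z \<in> polys n" using z(1) by (rule forms_subset_polys)
  have J': "ideal (ideal_insert n (z - 1) I) (mpoly_ring n)"
    using zp by (intro ideal_ideal_insert[OF J]) simp
  have "1 \<in> ideal_insert n (z - 1) I"
  proof (rule ccontr)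
    assume "1 \<notin> ideal_insert n (z - 1) I"
    then obtain x where x: "\<And>p. p \<in> ideal_insert n (z - 1) I \<Longrightarrow> eval_mpoly x p = 0"
      using common_zero_of_proper_ideal[OF J'] by blast
    have "eval_mpoly x (z - 1) = 0" using ideal_insert_self[OF J] by (rule x)
    moreover have "eval_mpoly x z = 0" using ideal_insert_superset x by (intro vanish) blast
    ultimately show False by (simp add: eval_mpoly_diff)
  qed
  then obtain p q where pq: "1 = p + q * (z - 1)" "p \<in> I" "q \<in> polys n"
    unfolding ideal_insert_def by blast
  then have "q + 1 = p + q * z" by (simp add: algebra_simps)
  then have comp_eq: "component b d q + component b d 1 =
      component b d p + (if e \<le> d then component b (d - e) q * z else 0)" for d
    unfolding component_mult_form[OF pq(3) z(1), symmetric] component_add[symmetric] by simp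
  have one: "component b d 1 = (if d = 0 then 1 else 0)" for d
    by (rule component_of_form[OF forms_one])
  \<comment> \<open>The induction step is the component of \<open>q + 1 = p + q * z\<close> in degree \<open>Suc k * e\<close>.\<close>
  have claim: "component b (k * e) q + z ^ k \<in> I" for k
  proof (induction k)
    case 0
    with comp_eq[of 0] z(2) comp[OF pq(2)] show ?case by (simp add: one)
  next
    case (Suc k)
    have "component b (Suc k * e) q + z ^ Suc k =
        component b (Suc k * e) p + z * (component b (k * e) q + z ^ k)"
      using comp_eq[of "Suc k * e"] z(2) by (simp add: one algebra_simps)
    also have "\<dots> \<in> I" by (rule ideal_add[OF J comp[OF pq(2)] ideal_mult[OF J Suc zp]])
    finally show ?case .
  qed
  define k where "k = Suc (\<Sum>m\<in>Poly_Mapping.keys q. monomial_degree b m)"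
  have "component b (k * e) q = 0"
  proof (rule poly_mapping_eqI)
    fix m
    have "monomial_degree b m \<noteq> k * e" if "m \<in> Poly_Mapping.keys q"
    proof -
      have "monomial_degree b m < k"
        unfolding k_def using that by (auto intro!: le_imp_less_Suc member_le_sum)
      also have "k \<le> k * e" using z(2) by simp
      finally show ?thesis by simp
    qed
    then show "Poly_Mapping.lookup (component b (k * e) q) m = Poly_Mapping.lookup 0 m"
      by (auto simp: lookup_component in_keys_iff)
  qed
  with claim[of k] show ?thesis by auto
qed

section \<open>Dimensions of graded pieces\<close>

context vector_space
begin

lemma finite_basis_exists:
  assumes "V \<subseteq> span A" "finite A"
  obtains B where "B \<subseteq> V" "independent B" "V \<subseteq> span B" "card B = dim V" "finite B"
proof -
  obtain B where B: "B \<subseteq> V" "independent B" "V \<subseteq> span B" "card B = dim V"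
    by (rule basis_exists)
  with assms independent_span_bound[of A B] that show ?thesis by blast
qed

lemma dim_mono_finite_span:
  assumes "V \<subseteq> W" "W \<subseteq> span A" "finite A"
  shows "dim V \<le> dim W"
proof -
  obtain B where "B \<subseteq> W" "independent B" "W \<subseteq> span B" "card B = dim W" "finite B"
    using finite_basis_exists[OF assms(2,3)] .
  then show ?thesis using dim_le_card[of V B] assms(1) by auto
qed

lemma subspace_eq_of_dim_eq:
  assumes "subspace V" "V \<subseteq> W" "W \<subseteq> span A" "finite A" "dim V = dim W"
  shows "V = W"
proof -
  obtain B where B: "B \<subseteq> V" "independent B" "V \<subseteq> span B" "card B = dim V" "finite B"
    using finite_basis_exists[OF order_trans[OF assms(2,3)] assms(4)] .
  obtain C where C: "B \<subseteq> C" "C \<subseteq> W" "independent C" "W \<subseteq> span C"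
    using maximal_independent_subset_extend[OF order_trans[OF B(1) assms(2)] B(2)] .
  have "finite C" using independent_span_bound[of A C] C assms(3,4) by blast
  moreover have "card C = dim W" using basis_card_eq_dim C by blast
  ultimately have "B = C" using card_subset_eq[of C B] C(1) B(4) assms(5) by simp
  with B C assms(1) have "W \<subseteq> V" using span_minimal by blast
  with assms(2) show ?thesis by blast
qed

text \<open>
  Rank and nullity for the composite of \<open>f\<close> with the projection to the quotient by \<open>K\<close>: a basis of
  the kernel inside \<open>U\<close> is extended to a basis of \<open>U\<close>, and the images of the added vectors together
  with a basis of \<open>K\<close> form a basis of \<open>K + f(U)\<close>. The ambient space may have infinite dimension.
\<close>

lemma dim_add_image:
  assumes f: "Vector_Spaces.linear scale scale f" and U: "subspace U" "U \<subseteq> span A" "finite A"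
    and K: "subspace K" "K \<subseteq> span A'" "finite A'"
  shows "dim {k + f u | k u. k \<in> K \<and> u \<in> U} + dim {u \<in> U. f u \<in> K} = dim K + dim U"
proof -
  interpret f: Vector_Spaces.linear scale scale f by (rule f)
  define N where "N = {u \<in> U. f u \<in> K}"
  define W where "W = {k + f u | k u. k \<in> K \<and> u \<in> U}"
  have N: "subspace N"
    using U(1) K(1) by (auto simp: N_def subspace_def f.add f.scale f.zero)
  have "N \<subseteq> U" by (auto simp: N_def)
  obtain BN where BN: "BN \<subseteq> N" "independent BN" "N \<subseteq> span BN" "card BN = dim N" "finite BN"
    using finite_basis_exists[OF order_trans[OF \<open>N \<subseteq> U\<close> U(2)] U(3)] .
  obtain BU where BU: "BN \<subseteq> BU" "BU \<subseteq> U" "independent BU" "U \<subseteq> span BU"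
    using maximal_independent_subset_extend[OF order_trans[OF BN(1) \<open>N \<subseteq> U\<close>] BN(2)] .
  have finBU: "finite BU" using independent_span_bound[of A BU] BU U by blast
  have cardBU: "card BU = dim U" using basis_card_eq_dim BU by blast
  obtain BK where BK: "BK \<subseteq> K" "independent BK" "K \<subseteq> span BK" "card BK = dim K" "finite BK"
    using finite_basis_exists[OF K(2,3)] .
  have spanBK: "span BK = K" using span_minimal[OF BK(1) K(1)] BK(3) by blast
  have key: "independent (BK \<union> f ` D) \<and> card (BK \<union> f ` D) = card BK + card D"
    if "finite D" "D \<subseteq> BU - BN" for D
    using that
  proof (induction D rule: finite_induct)
    case empty
    then show ?case using BK by simp
  next
    case (insert u D)
    have "f u \<notin> span (BK \<union> f ` D)"
    proof
      assume "f u \<in> span (BK \<union> f ` D)"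
      then obtain k w where kw: "f u = k + f w" "k \<in> K" "w \<in> span D"
        unfolding span_Un spanBK f.span_image by blast
      have "u \<in> U" using insert.prems BU(2) by blast
      have "span D \<subseteq> U" using insert.prems BU(2) by (intro span_minimal U(1)) blast
      then have "u - w \<in> U" using \<open>u \<in> U\<close> kw(3) subspace_diff[OF U(1)] by blast
      moreover have "f (u - w) \<in> K" using kw(1,2) by (simp add: f.diff)
      ultimately have "u - w \<in> span BN" using BN(3) by (auto simp: N_def)
      then have "u - w \<in> span (BU - {u})"
        using span_mono[of BN "BU - {u}"] insert.prems BU(1) by blast
      moreover have "w \<in> span (BU - {u})"
        using kw(3) span_mono[of D "BU - {u}"] insert by blast
      ultimately have "(u - w) + w \<in> span (BU - {u})" by (rule span_add)
      then have "u \<in> span (BU - {u})" by simp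
      moreover have "u \<in> BU" using insert.prems by blast
      ultimately show False using BU(3) by (auto simp: dependent_def)
    qed
    moreover from this have "f u \<notin> BK \<union> f ` D"
      using span_superset[of "BK \<union> f ` D"] by blast
    moreover have "independent (BK \<union> f ` D)" "card (BK \<union> f ` D) = card BK + card D"
      using insert.IH insert.prems by blast+
    ultimately show ?case
      using insert.hyps BK(5) independent_insertI[of "f u" "BK \<union> f ` D"] by simp
  qed
  define B where "B = BK \<union> f ` (BU - BN)"
  have B: "independent B" "card B = card BK + card (BU - BN)"
    using key[of "BU - BN"] finBU by (auto simp: B_def)
  have "B \<subseteq> W"
  proof -
    have W: "k + f u \<in> W" if "k \<in> K" "u \<in> U" for k u using that unfolding W_def by blast
    have "k \<in> W" if "k \<in> K" for k
      using W[OF that subspace_0[OF U(1)]] by (simp add: f.zero)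
    moreover have "f u \<in> W" if "u \<in> U" for u
      using W[OF subspace_0[OF K(1)] that] by simp
    ultimately show ?thesis using BK(1) BU(2) by (auto simp: B_def)
  qed
  moreover have "W \<subseteq> span B"
  proof
    fix x assume "x \<in> W"
    then obtain k u where x: "x = k + f u" "k \<in> K" "u \<in> U" by (auto simp: W_def)
    have "k \<in> span B" using x(2) spanBK span_mono[of BK B] by (auto simp: B_def)
    moreover have "f u \<in> span B"
    proof -
      have "f v \<in> span B" if "v \<in> BU" for v
      proof (cases "v \<in> BN")
        case True
        then have "f v \<in> span BK" using BN(1) spanBK by (auto simp: N_def)
        then show ?thesis using span_mono[of BK B] by (auto simp: B_def)
      next
        case False
        with that show ?thesis by (auto simp: B_def intro: span_base)
      qed
      then have "span (f ` BU) \<subseteq> span B" by (intro span_minimal) auto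
      then show ?thesis using x(3) BU(4) unfolding f.span_image by blast
    qed
    ultimately show "x \<in> span B" unfolding x(1) by (rule span_add)
  qed
  ultimately have "dim W = card B" using basis_card_eq_dim B(1) by metis
  moreover have "card (BU - BN) + card BN = card BU"
    using card_Diff_subset[OF BN(5) BU(1)] card_mono[OF finBU BU(1)] by simp
  ultimately show ?thesis unfolding N_def[symmetric] W_def[symmetric]
    using B(2) BN(4) BK(4) cardBU by simp
qed

end

interpretation mpoly: vector_space "\<lambda>c (p :: mpoly). cst c * p"
  by unfold_locales (auto simp: algebra_simps single_add mult_single)

lemma subspace_ideal: "ideal J (mpoly_ring n) \<Longrightarrow> mpoly.subspace J"
  by (auto simp: mpoly.subspace_def intro: ideal_zero ideal_add ideal_mult[where r = "cst _"])

lemma subspace_forms: "mpoly.subspace (forms n b d)"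
proof -
  have "cst c * p \<in> forms n b d" if "p \<in> forms n b d" for c p
    using that by (auto simp: forms_def in_keys_iff)
  then show ?thesis by (simp add: mpoly.subspace_def forms_add)
qed

lemma forms_subset_span:
  assumes "finite (monoms n b d)"
  shows "forms n b d \<subseteq> mpoly.span ((\<lambda>m. Poly_Mapping.single m 1) ` monoms n b d)"
proof
  fix p assume "p \<in> forms n b d"
  then have "p = (\<Sum>m\<in>monoms n b d. Poly_Mapping.single m (Poly_Mapping.lookup p m))"
    using assms by (intro mpoly_eq_sum_monomials) (auto simp: forms_def)
  also have "\<dots> = (\<Sum>m\<in>monoms n b d. cst (Poly_Mapping.lookup p m) * Poly_Mapping.single m 1)"
    by (simp add: mult_single)
  also have "\<dots> \<in> mpoly.span ((\<lambda>m. Poly_Mapping.single m 1) ` monoms n b d)"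
    by (intro mpoly.span_sum mpoly.span_scale mpoly.span_base) auto
  finally show "p \<in> mpoly.span ((\<lambda>m. Poly_Mapping.single m 1) ` monoms n b d)" .
qed

lemma linear_mult_right: "Vector_Spaces.linear (\<lambda>c p. cst c * p) (\<lambda>c p. cst c * p) (\<lambda>u. u * g)"
  by unfold_locales (auto simp: algebra_simps)

lemma finite_monoms_card:
  assumes "\<forall>i\<in>{1..n}. b i > 0"
  shows "finite (monoms n b d) \<and> card (monoms n b d) \<le> (d + 1) ^ n"
proof -
  let ?f = "\<lambda>m. restrict (Poly_Mapping.lookup m) {1..n}"
  have inj: "inj_on ?f (monoms n b d)"
  proof (rule inj_onI)
    fix m m' assume *: "m \<in> monoms n b d" "m' \<in> monoms n b d" "?f m = ?f m'"
    show "m = m'"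
    proof (rule poly_mapping_eqI)
      fix k show "Poly_Mapping.lookup m k = Poly_Mapping.lookup m' k"
      proof (cases "k \<in> {1..n}")
        case True
        with fun_cong[OF *(3), of k] show ?thesis by simp
      next
        case False
        then have "k \<notin> Poly_Mapping.keys m" "k \<notin> Poly_Mapping.keys m'"
          using * unfolding monoms_def by blast+
        then show ?thesis by (simp add: in_keys_iff)
      qed
    qed
  qed
  \<comment> \<open>Positive weights bound every exponent by the degree.\<close>
  have "?f ` monoms n b d \<subseteq> {1..n} \<rightarrow>\<^sub>E {0..d}"
  proof clarify
    fix m assume m: "m \<in> monoms n b d"
    have "Poly_Mapping.lookup m i \<le> d" if i: "i \<in> {1..n}" for i
    proof -
      have "Poly_Mapping.lookup m i * 1 \<le> Poly_Mapping.lookup m i * b i"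
        using assms i by (intro mult_le_mono) (auto simp: Suc_le_eq)
      also have "\<dots> \<le> (\<Sum>i\<in>{1..n}. Poly_Mapping.lookup m i * b i)"
        by (rule member_le_sum[OF i]) auto
      also have "\<dots> = d"
        using m monomial_degree_superset[of "{1..n}" m b] by (auto simp: monoms_def)
      finally show ?thesis by simp
    qed
    then show "?f m \<in> {1..n} \<rightarrow>\<^sub>E {0..d}" by auto
  qed
  moreover have "finite ({1..n} \<rightarrow>\<^sub>E {0..d})" by (intro finite_PiE) auto
  moreover have "card ({1..n} \<rightarrow>\<^sub>E {0..d}) = (d + 1) ^ n" by (simp add: card_PiE)
  ultimately have "finite (?f ` monoms n b d)" "card (?f ` monoms n b d) \<le> (d + 1) ^ n"
    using finite_subset card_mono by (blast, metis)
  then show ?thesis using finite_imageD[OF _ inj] card_image[OF inj] by simp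
qed

lemma summable_polynomial_times_power:
  fixes t :: real
  assumes "0 < t" "t < 1"
  shows "summable (\<lambda>d. real ((d + 1) ^ n) * t ^ d)"
proof -
  have "(\<lambda>d. (1 + inverse (real (Suc d))) ^ n * t) \<longlonglongrightarrow> (1 + 0) ^ n * t"
    by (intro tendsto_intros LIMSEQ_inverse_real_of_nat)
  then have "(\<lambda>d. (1 + inverse (real (Suc d))) ^ n * t) \<longlonglongrightarrow> t" by simp
  then have "eventually (\<lambda>d. (1 + inverse (real (Suc d))) ^ n * t < (1 + t) / 2) sequentially"
    using assms by (intro order_tendstoD) auto
  then obtain N where N: "\<And>d. d \<ge> N \<Longrightarrow> (1 + inverse (real (Suc d))) ^ n * t < (1 + t) / 2"
    by (auto simp: eventually_sequentially)
  show ?thesis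
  proof (rule summable_ratio_test)
    show "(1 + t) / 2 < 1" using assms by simp
    fix d assume "N \<le> d"
    have "real ((Suc d + 1) ^ n) * t ^ Suc d =
        ((1 + inverse (real (Suc d))) ^ n * t) * (real ((d + 1) ^ n) * t ^ d)"
    proof -
      have "real (Suc d + 1) = (1 + inverse (real (Suc d))) * real (d + 1)"
        by (simp add: field_simps)
      then have "real ((Suc d + 1) ^ n) = (1 + inverse (real (Suc d))) ^ n * real ((d + 1) ^ n)"
        by (metis of_nat_power power_mult_distrib)
      then show ?thesis by simp
    qed
    also have "\<dots> \<le> (1 + t) / 2 * (real ((d + 1) ^ n) * t ^ d)"
      using N[OF \<open>N \<le> d\<close>] assms by (intro mult_right_mono) auto
    finally show "norm (real ((Suc d + 1) ^ n) * t ^ Suc d) \<le> (1 + t) / 2 * norm (real ((d + 1) ^ n) * t ^ d)"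
      using assms by (simp add: abs_mult)
  qed
qed

section \<open>Hilbert series\<close>

text \<open>
  The dimension of the degree \<open>d\<close> part of \<open>R/J\<close>, as a real number so that it can be a coefficient.
\<close>

definition hilbert_fun :: "nat \<Rightarrow> (nat \<Rightarrow> nat) \<Rightarrow> mpoly set \<Rightarrow> nat \<Rightarrow> real" where
  "hilbert_fun n b J d = real (mpoly.dim (forms n b d)) - real (mpoly.dim (J \<inter> forms n b d))"

definition hilbert_series :: "nat \<Rightarrow> (nat \<Rightarrow> nat) \<Rightarrow> real \<Rightarrow> mpoly set \<Rightarrow> real" where
  "hilbert_series n b t J = suminf (\<lambda>d. hilbert_fun n b J d * t ^ d)"

definition colon :: "nat \<Rightarrow> mpoly set \<Rightarrow> mpoly \<Rightarrow> mpoly set" where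
  "colon n J g = {u \<in> polys n. u * g \<in> J}"

lemma subset_colon:
  assumes "ideal J (mpoly_ring n)" "g \<in> polys n"
  shows "J \<subseteq> colon n J g"
  using assms ideal_subset_polys[OF assms(1)] ideal_mult_right[OF assms(1)] by (auto simp: colon_def)

context
  fixes n :: nat and b :: "nat \<Rightarrow> nat"
  assumes pos: "\<forall>i\<in>{1..n}. b i > 0"
begin

lemma forms_span:
  obtains A where "finite A" "forms n b d \<subseteq> mpoly.span A" "card A \<le> (d + 1) ^ n"
proof
  show "finite ((\<lambda>m. Poly_Mapping.single m (1::complex)) ` monoms n b d)"
    using finite_monoms_card[OF pos] by simp
  show "forms n b d \<subseteq> mpoly.span ((\<lambda>m. Poly_Mapping.single m 1) ` monoms n b d)"
    using finite_monoms_card[OF pos] by (intro forms_subset_span) simp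
  show "card ((\<lambda>m. Poly_Mapping.single m (1::complex)) ` monoms n b d) \<le> (d + 1) ^ n"
    using finite_monoms_card[OF pos, of d]
    by (intro order_trans[OF card_image_le]) auto
qed

lemma hilbert_fun_nonneg: "0 \<le> hilbert_fun n b J d"
proof -
  obtain A where "finite A" "forms n b d \<subseteq> mpoly.span A" by (rule forms_span)
  then show ?thesis
    using mpoly.dim_mono_finite_span[of "J \<inter> forms n b d" "forms n b d" A] by (simp add: hilbert_fun_def)
qed

lemma hilbert_fun_antimono:
  assumes "J \<subseteq> J'"
  shows "hilbert_fun n b J' d \<le> hilbert_fun n b J d"
proof -
  obtain A where "finite A" "forms n b d \<subseteq> mpoly.span A" by (rule forms_span)
  with assms have "mpoly.dim (J \<inter> forms n b d) \<le> mpoly.dim (J' \<inter> forms n b d)"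
    by (intro mpoly.dim_mono_finite_span[where A = A]) auto
  then show ?thesis by (simp add: hilbert_fun_def)
qed

lemma hilbert_fun_eqD:
  assumes "ideal J (mpoly_ring n)" "J \<subseteq> J'" "hilbert_fun n b J' d = hilbert_fun n b J d"
  shows "J \<inter> forms n b d = J' \<inter> forms n b d"
proof -
  obtain A where "finite A" "forms n b d \<subseteq> mpoly.span A" by (rule forms_span)
  with assms show ?thesis
    by (intro mpoly.subspace_eq_of_dim_eq[where A = A] mpoly.subspace_inter subspace_ideal subspace_forms)
      (auto simp: hilbert_fun_def)
qed

lemma hilbert_fun_le: "hilbert_fun n b J d \<le> real ((d + 1) ^ n)"
proof -
  obtain A where A: "finite A" "forms n b d \<subseteq> mpoly.span A" "card A \<le> (d + 1) ^ n" by (rule forms_span)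
  then have "mpoly.dim (forms n b d) \<le> (d + 1) ^ n"
    using mpoly.dim_le_card[OF A(2,1)] by linarith
  then have "real (mpoly.dim (forms n b d)) \<le> real ((d + 1) ^ n)" by (simp only: of_nat_le_iff)
  then show ?thesis by (simp add: hilbert_fun_def)
qed

text \<open>
  In degree \<open>d\<close> the quotient loses the image of multiplication by \<open>g\<close> from degree \<open>d - e\<close>, and the
  kernel of this multiplication into \<open>R/J\<close> is the colon ideal.
\<close>

lemma hilbert_fun_ideal_insert:
  assumes J: "graded_ideal n b J" and g: "g \<in> forms n b e"
  shows "hilbert_fun n b (ideal_insert n g J) d =
    hilbert_fun n b J d - (if e \<le> d then hilbert_fun n b (colon n J g) (d - e) else 0)"
proof -
  have JI: "ideal J (mpoly_ring n)" using J by (simp add: graded_ideal_def)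
  have in_forms: "x \<in> ideal_insert n g J \<inter> forms n b d \<longleftrightarrow>
      (\<exists>k u. x = k + (if e \<le> d then u * g else 0) \<and> k \<in> J \<inter> forms n b d \<and> u \<in> forms n b (d - e))" for x
  proof
    assume x: "x \<in> ideal_insert n g J \<inter> forms n b d"
    then obtain p q where pq: "x = p + q * g" "p \<in> J" "q \<in> polys n" by (auto simp: ideal_insert_def)
    have "x = component b d x" using x component_of_form[of x n b d d] by simp
    also have "\<dots> = component b d p + (if e \<le> d then component b (d - e) q * g else 0)"
      unfolding pq(1) component_add component_mult_form[OF pq(3) g] by simp
    finally have "x = component b d p + (if e \<le> d then component b (d - e) q * g else 0)" .
    moreover have "component b d p \<in> J \<inter> forms n b d"
      using J pq(2) component_in_forms[OF ideal_subset_polys[OF JI pq(2)]] by (simp add: graded_ideal_def)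
    moreover have "component b (d - e) q \<in> forms n b (d - e)" by (rule component_in_forms[OF pq(3)])
    ultimately show "\<exists>k u. x = k + (if e \<le> d then u * g else 0) \<and> k \<in> J \<inter> forms n b d \<and> u \<in> forms n b (d - e)"
      by blast
  next
    assume "\<exists>k u. x = k + (if e \<le> d then u * g else 0) \<and> k \<in> J \<inter> forms n b d \<and> u \<in> forms n b (d - e)"
    then obtain k u where ku: "x = k + (if e \<le> d then u * g else 0)" "k \<in> J" "k \<in> forms n b d"
      "u \<in> forms n b (d - e)" by blast
    then have x: "x = k + (if e \<le> d then u else 0) * g" "k \<in> J" "k \<in> forms n b d" "u \<in> forms n b (d - e)"
      by simp_all
    have "x \<in> ideal_insert n g J"
      unfolding x(1) using x(2) forms_subset_polys[OF x(4)] by (intro ideal_insertI) auto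
    moreover have "x \<in> forms n b d"
      unfolding x(1) using x forms_mult[OF x(4) g] by (auto intro!: forms_add)
    ultimately show "x \<in> ideal_insert n g J \<inter> forms n b d" by blast
  qed
  show ?thesis
  proof (cases "e \<le> d")
    case False
    have "ideal_insert n g J \<inter> forms n b d \<subseteq> J \<inter> forms n b d"
    proof
      fix x assume "x \<in> ideal_insert n g J \<inter> forms n b d"
      with in_forms[of x] False show "x \<in> J \<inter> forms n b d" by auto
    qed
    moreover have "J \<inter> forms n b d \<subseteq> ideal_insert n g J \<inter> forms n b d"
      using ideal_insert_superset by blast
    ultimately have "ideal_insert n g J \<inter> forms n b d = J \<inter> forms n b d" by (rule subset_antisym)
    with False show ?thesis by (simp add: hilbert_fun_def)
  next
    case True
    obtain A where A: "finite A" "forms n b (d - e) \<subseteq> mpoly.span A" by (rule forms_span)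
    obtain A' where A': "finite A'" "forms n b d \<subseteq> mpoly.span A'" by (rule forms_span)
    have "ideal_insert n g J \<inter> forms n b d =
        {k + u * g | k u. k \<in> J \<inter> forms n b d \<and> u \<in> forms n b (d - e)}"
    proof (rule Set.set_eqI)
      fix x
      show "x \<in> ideal_insert n g J \<inter> forms n b d \<longleftrightarrow>
          x \<in> {k + u * g | k u. k \<in> J \<inter> forms n b d \<and> u \<in> forms n b (d - e)}"
        unfolding in_forms[of x] mem_Collect_eq by (simp only: if_P[OF True])
    qed
    moreover have "u * g \<in> forms n b d" if "u \<in> forms n b (d - e)" for u
      using forms_mult[OF that g] True by simp
    then have "colon n J g \<inter> forms n b (d - e) = {u \<in> forms n b (d - e). u * g \<in> J \<inter> forms n b d}"
      using forms_subset_polys[of _ n b "d - e"] unfolding colon_def by blast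
    moreover have "mpoly.dim {k + u * g | k u. k \<in> J \<inter> forms n b d \<and> u \<in> forms n b (d - e)}
      + mpoly.dim {u \<in> forms n b (d - e). u * g \<in> J \<inter> forms n b d}
      = mpoly.dim (J \<inter> forms n b d) + mpoly.dim (forms n b (d - e))"
      using A A' by (intro mpoly.dim_add_image[where A = A and A' = A'] linear_mult_right
        mpoly.subspace_inter subspace_ideal[OF JI] subspace_forms) auto
    ultimately show ?thesis using True by (simp add: hilbert_fun_def)
  qed
qed

context
  fixes t :: real
  assumes t: "0 < t" "t < 1"
begin

lemma summable_hilbert_fun: "summable (\<lambda>d. hilbert_fun n b J d * t ^ d)"
proof (rule summable_comparison_test'[OF summable_polynomial_times_power[OF t, of n]])
  fix d
  show "norm (hilbert_fun n b J d * t ^ d) \<le> real ((d + 1) ^ n) * t ^ d"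
    using t hilbert_fun_nonneg[of J d] hilbert_fun_le[of J d] by (simp add: abs_mult mult_right_mono del: of_nat_power of_nat_add)
qed

lemma hilbert_series_antimono:
  "J \<subseteq> J' \<Longrightarrow> hilbert_series n b t J' \<le> hilbert_series n b t J"
  unfolding hilbert_series_def
  using t by (intro suminf_le summable_hilbert_fun mult_right_mono hilbert_fun_antimono) auto

lemma hilbert_series_ideal_insert:
  assumes "graded_ideal n b J" "g \<in> forms n b e"
  shows "hilbert_series n b t (ideal_insert n g J) =
    hilbert_series n b t J - t ^ e * hilbert_series n b t (colon n J g)"
proof -
  let ?q = "\<lambda>d. if e \<le> d then hilbert_fun n b (colon n J g) (d - e) * t ^ d else 0"
  have "(\<lambda>d. ?q (d + e)) = (\<lambda>d. t ^ e * (hilbert_fun n b (colon n J g) d * t ^ d))"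
    by (auto simp: power_add)
  moreover have "\<dots> sums (t ^ e * hilbert_series n b t (colon n J g))"
    unfolding hilbert_series_def by (intro sums_mult summable_sums summable_hilbert_fun)
  ultimately have "?q sums (t ^ e * hilbert_series n b t (colon n J g))"
    using sums_iff_shift'[of ?q e "t ^ e * hilbert_series n b t (colon n J g)"] by simp
  moreover have "(\<lambda>d. hilbert_fun n b J d * t ^ d) sums hilbert_series n b t J"
    unfolding hilbert_series_def by (intro summable_sums summable_hilbert_fun)
  ultimately have "(\<lambda>d. hilbert_fun n b J d * t ^ d - ?q d) sums
      (hilbert_series n b t J - t ^ e * hilbert_series n b t (colon n J g))"
    by (intro sums_diff)
  moreover have "(\<lambda>d. hilbert_fun n b J d * t ^ d - ?q d) = (\<lambda>d. hilbert_fun n b (ideal_insert n g J) d * t ^ d)"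
    by (auto simp: hilbert_fun_ideal_insert[OF assms] left_diff_distrib)
  ultimately show ?thesis by (simp add: hilbert_series_def sums_iff)
qed

lemma hilbert_series_ideal_insert_ge:
  assumes "graded_ideal n b J" "g \<in> forms n b e"
  shows "(1 - t ^ e) * hilbert_series n b t J \<le> hilbert_series n b t (ideal_insert n g J)"
proof -
  have "hilbert_series n b t (colon n J g) \<le> hilbert_series n b t J"
    using assms(1) forms_subset_polys[OF assms(2)]
    by (intro hilbert_series_antimono subset_colon) (auto simp: graded_ideal_def)
  then have "t ^ e * hilbert_series n b t (colon n J g) \<le> t ^ e * hilbert_series n b t J"
    using t by simp
  then show ?thesis by (simp add: hilbert_series_ideal_insert[OF assms] left_diff_distrib)
qed

text \<open>
  The defect in the inequality is \<open>t\<^sup>e\<close> times the difference of the series of \<open>J\<close> and of its colon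
  ideal. The coefficients of that difference are non-negative, so it vanishes at one positive \<open>t\<close>
  only if it vanishes coefficientwise, and then the two graded ideals agree.
\<close>

lemma hilbert_series_ideal_insert_eq_iff:
  assumes J: "graded_ideal n b J" and g: "g \<in> forms n b e"
  shows "hilbert_series n b t (ideal_insert n g J) = (1 - t ^ e) * hilbert_series n b t J
    \<longleftrightarrow> (\<forall>u\<in>polys n. u * g \<in> J \<longrightarrow> u \<in> J)"
proof
  have JI: "ideal J (mpoly_ring n)" using J by (simp add: graded_ideal_def)
  have gp: "g \<in> polys n" using g by (rule forms_subset_polys)
  note sub = subset_colon[OF JI gp]
  {
    assume "hilbert_series n b t (ideal_insert n g J) = (1 - t ^ e) * hilbert_series n b t J"
    then have "t ^ e * hilbert_series n b t J = t ^ e * hilbert_series n b t (colon n J g)"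
      unfolding hilbert_series_ideal_insert[OF assms] left_diff_distrib by linarith
    moreover have "t ^ e \<noteq> 0" using t by simp
    ultimately have "hilbert_series n b t J = hilbert_series n b t (colon n J g)"
      by (metis mult_left_cancel)
    then have "suminf (\<lambda>d. hilbert_fun n b J d * t ^ d - hilbert_fun n b (colon n J g) d * t ^ d) = 0"
      by (subst suminf_diff[symmetric]) (auto simp: summable_hilbert_fun hilbert_series_def)
    moreover have "summable (\<lambda>d. hilbert_fun n b J d * t ^ d - hilbert_fun n b (colon n J g) d * t ^ d)"
      by (intro summable_diff summable_hilbert_fun)
    moreover have "0 \<le> hilbert_fun n b J d * t ^ d - hilbert_fun n b (colon n J g) d * t ^ d" for d
      using t hilbert_fun_antimono[OF sub, of d] by (simp add: mult_right_mono)
    ultimately have "\<forall>d. hilbert_fun n b J d * t ^ d - hilbert_fun n b (colon n J g) d * t ^ d = 0"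
      by (subst (asm) suminf_eq_zero_iff) simp_all
    then have "hilbert_fun n b (colon n J g) d = hilbert_fun n b J d" for d
      using t by (simp flip: left_diff_distrib)
    then have eq: "J \<inter> forms n b d = colon n J g \<inter> forms n b d" for d
      using hilbert_fun_eqD[OF JI sub] by blast
    show "\<forall>u\<in>polys n. u * g \<in> J \<longrightarrow> u \<in> J"
    proof (intro ballI impI)
      fix u assume u: "u \<in> polys n" "u * g \<in> J"
      have "component b d u \<in> J" for d
      proof -
        have "component b (d + e) (u * g) \<in> J" using J u by (auto simp: graded_ideal_def)
        then have "component b d u * g \<in> J" by (simp add: component_mult_form[OF u(1) g])
        then have "component b d u \<in> colon n J g \<inter> forms n b d"
          using u by (auto simp: colon_def intro: component_in_forms)
        with eq show ?thesis by blast
      qed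
      then have "(\<Sum>d\<in>monomial_degree b ` Poly_Mapping.keys u. component b d u) \<in> J"
        by (rule ideal_sum[OF JI])
      then show "u \<in> J" by (simp add: sum_components)
    qed
  }
  {
    assume "\<forall>u\<in>polys n. u * g \<in> J \<longrightarrow> u \<in> J"
    then have "colon n J g = J" using sub by (auto simp: colon_def)
    then show "hilbert_series n b t (ideal_insert n g J) = (1 - t ^ e) * hilbert_series n b t J"
      by (simp add: hilbert_series_ideal_insert[OF assms] left_diff_distrib)
  }
qed

end

end

section \<open>General forms of prescribed degrees\<close>

text \<open>
  The coordinates of \<open>v\<close> are chosen one after another: the coordinate at \<open>s\<close> is taken so large that
  it dominates every form in which it occurs, and the other forms are dealt with by induction.
\<close>

lemma exists_vector_large_on_forms:
  fixes \<phi> :: "'k \<Rightarrow> 's \<Rightarrow> real" and \<beta> :: "'k \<Rightarrow> real"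
  assumes "finite S" "finite \<Theta>" "\<And>\<theta>. \<theta> \<in> \<Theta> \<Longrightarrow> \<exists>s\<in>S. \<phi> \<theta> s \<noteq> 0"
  shows "\<exists>v. \<forall>\<theta>\<in>\<Theta>. \<beta> \<theta> < \<bar>\<Sum>s\<in>S. \<phi> \<theta> s * v s\<bar>"
  using assms
proof (induction S arbitrary: \<Theta> rule: finite_induct)
  case empty
  then show ?case by auto
next
  case (insert s S)
  have "\<exists>v. \<forall>\<theta>\<in>{\<theta>\<in>\<Theta>. \<phi> \<theta> s = 0}. \<beta> \<theta> < \<bar>\<Sum>s\<in>S. \<phi> \<theta> s * v s\<bar>"
    using insert.prems by (intro insert.IH) fastforce+
  then obtain v where v: "\<And>\<theta>. \<theta> \<in> \<Theta> \<Longrightarrow> \<phi> \<theta> s = 0 \<Longrightarrow> \<beta> \<theta> < \<bar>\<Sum>s\<in>S. \<phi> \<theta> s * v s\<bar>"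
    by auto
  define rest where "rest = (\<lambda>\<theta>. \<Sum>s\<in>S. \<phi> \<theta> s * v s)"
  define bound where "bound = (\<lambda>\<theta>. (\<bar>\<beta> \<theta>\<bar> + 1 + \<bar>rest \<theta>\<bar>) / \<bar>\<phi> \<theta> s\<bar>)"
  \<comment> \<open>All bounds are non-negative, so their sum is at least each of them.\<close>
  define w where "w = (\<Sum>\<theta>\<in>\<Theta>. bound \<theta>)"
  have sum: "(\<Sum>s'\<in>insert s S. \<phi> \<theta> s' * (v(s := w)) s') = \<phi> \<theta> s * w + rest \<theta>" for \<theta>
    using insert.hyps by (auto simp: rest_def intro!: sum.cong)
  have "\<beta> \<theta> < \<bar>\<phi> \<theta> s * w + rest \<theta>\<bar>" if \<theta>: "\<theta> \<in> \<Theta>" for \<theta>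
  proof (cases "\<phi> \<theta> s = 0")
    case True
    then show ?thesis using v[OF \<theta>] by (simp add: rest_def)
  next
    case False
    have "bound \<theta> \<le> w"
      unfolding w_def using \<theta> insert.prems(1) by (intro member_le_sum) (auto simp: bound_def)
    then have "\<bar>\<phi> \<theta> s\<bar> * bound \<theta> \<le> \<bar>\<phi> \<theta> s\<bar> * w" by (intro mult_left_mono) auto
    also have "\<bar>\<phi> \<theta> s\<bar> * w \<le> \<bar>\<phi> \<theta> s * w\<bar>" by (simp add: abs_mult mult_left_mono)
    also have "\<bar>\<phi> \<theta> s\<bar> * bound \<theta> = \<bar>\<beta> \<theta>\<bar> + 1 + \<bar>rest \<theta>\<bar>" using False by (simp add: bound_def)
    finally show ?thesis by linarith
  qed
  then show ?case by (intro exI[of _ "v(s := w)"] ballI) (simp only: sum)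
qed

text \<open>
  A term of maximal absolute value is cancelled by the fewer than \<open>card A\<close> others, so one of these is
  smaller by at most the factor \<open>card A\<close>.
\<close>

lemma comparable_terms_of_zero_sum:
  fixes z :: "'a \<Rightarrow> complex"
  assumes "finite A" "a \<in> A" "z a \<noteq> 0" "(\<Sum>x\<in>A. z x) = 0"
  shows "\<exists>x\<in>A. \<exists>y\<in>A. x \<noteq> y \<and> z x \<noteq> 0 \<and> z y \<noteq> 0 \<and> norm (z y) \<le> norm (z x) \<and>
    norm (z x) \<le> real (card A) * norm (z y)"
proof -
  have "Max ((\<lambda>x. norm (z x)) ` A) \<in> (\<lambda>x. norm (z x)) ` A"
    using assms(1,2) by (intro Max_in) auto
  then obtain x where "x \<in> A" "Max ((\<lambda>x. norm (z x)) ` A) = norm (z x)" by blast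
  with assms(1) have x: "x \<in> A" "\<And>y. y \<in> A \<Longrightarrow> norm (z y) \<le> norm (z x)"
    by (auto dest!: sym[of "Max _"])
  have zx: "0 < norm (z x)" using x(2)[OF assms(2)] assms(3) by (smt (verit) zero_less_norm_iff)
  have "\<exists>y\<in>A - {x}. norm (z x) \<le> real (card A) * norm (z y)"
  proof (rule ccontr)
    assume "\<not> ?thesis"
    then have less: "real (card A) * norm (z y) < norm (z x)" if "y \<in> A - {x}" for y
      using that by (auto simp: not_le)
    have "z x = - (\<Sum>y\<in>A - {x}. z y)"
      using assms(4) by (simp add: sum.remove[OF assms(1) x(1)] add_eq_0_iff2)
    then have "norm (z x) \<le> (\<Sum>y\<in>A - {x}. norm (z y))" by (simp add: norm_sum)
    then have "real (card A) * norm (z x) \<le> (\<Sum>y\<in>A - {x}. real (card A) * norm (z y))"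
      by (simp add: mult_left_mono flip: sum_distrib_left)
    also have "\<dots> \<le> (\<Sum>y\<in>A - {x}. norm (z x))" using less by (intro sum_mono) (auto intro: less_imp_le)
    also have "\<dots> = (real (card A) - 1) * norm (z x)"
      using card.remove[OF assms(1) x(1)] by simp
    finally show False using zx by (simp add: left_diff_distrib)
  qed
  then obtain y where y: "y \<in> A - {x}" "norm (z x) \<le> real (card A) * norm (z y)" by blast
  with zx have "z y \<noteq> 0" by auto
  with x y zx show ?thesis by (intro bexI[of _ x] bexI[of _ y]) auto
qed

text \<open>
  The differences of exponent vectors of equal degree are orthogonal to the positive weight vector.
  They live in a space of dimension \<open>card I - 1\<close>, which is less than their number.
\<close>

lemma linear_relation_of_monomial_differences:
  fixes \<mu> \<mu>' :: "nat \<Rightarrow> (nat \<Rightarrow>\<^sub>0 nat)" and b d :: "nat \<Rightarrow> nat"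
  assumes pos: "\<forall>i\<in>{1..n}. b i > 0" and I: "I \<subseteq> {1..n}" "I \<noteq> {}" and K: "finite K" "card I \<le> card K"
    and \<mu>: "\<And>i. i \<in> K \<Longrightarrow> \<mu> i \<in> monoms n b (d i) \<and> Poly_Mapping.keys (\<mu> i) \<subseteq> I"
    and \<mu>': "\<And>i. i \<in> K \<Longrightarrow> \<mu>' i \<in> monoms n b (d i) \<and> Poly_Mapping.keys (\<mu>' i) \<subseteq> I"
  shows "\<exists>c :: nat \<Rightarrow> real. (\<exists>i\<in>K. c i \<noteq> 0) \<and> (\<forall>l\<in>I. (\<Sum>i\<in>K.
    (real (Poly_Mapping.lookup (\<mu> i) l) - real (Poly_Mapping.lookup (\<mu>' i) l)) * c i) = 0)"
proof -
  have fin: "finite I" using I(1) finite_subset by blast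
  obtain l0 where l0: "l0 \<in> I" using I(2) by blast
  define D where "D = (\<lambda>l i. real (Poly_Mapping.lookup (\<mu> i) l) - real (Poly_Mapping.lookup (\<mu>' i) l))"
  \<comment> \<open>The equation at \<open>l0\<close> is dropped; orthogonality to the weights recovers it from the others.\<close>
  have "card (I - {l0}) < card K"
    using card_Diff1_less[OF fin l0] K(2) by linarith
  then obtain c where c: "\<exists>i\<in>K. c i \<noteq> 0" "\<And>l. l \<in> I - {l0} \<Longrightarrow> (\<Sum>i\<in>K. D l i * c i) = 0"
    using homogeneous_system_solution[of "I - {l0}" K D] fin K(1) by blast
  have orth: "(\<Sum>l\<in>I. real (b l) * D l i) = 0" if "i \<in> K" for i
  proof -
    have "real (d i) = (\<Sum>l\<in>I. real (Poly_Mapping.lookup (\<mu> i) l) * real (b l))"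
      using \<mu>[OF that] monomial_degree_superset[OF fin, of "\<mu> i" b] by (auto simp: monoms_def)
    moreover have "real (d i) = (\<Sum>l\<in>I. real (Poly_Mapping.lookup (\<mu>' i) l) * real (b l))"
      using \<mu>'[OF that] monomial_degree_superset[OF fin, of "\<mu>' i" b] by (auto simp: monoms_def)
    ultimately show ?thesis by (simp add: D_def right_diff_distrib sum_subtractf mult.commute)
  qed
  have "(\<Sum>l\<in>I. real (b l) * (\<Sum>i\<in>K. D l i * c i)) = (\<Sum>i\<in>K. c i * (\<Sum>l\<in>I. real (b l) * D l i))"
    unfolding sum_distrib_left by (subst sum.swap) (simp add: mult_ac)
  also have "\<dots> = 0" using orth by simp
  finally have "real (b l0) * (\<Sum>i\<in>K. D l0 i * c i) = 0"
    unfolding sum.remove[OF fin l0] using c(2) by simp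
  moreover have "0 < b l0" using pos I(1) l0 by blast
  ultimately have "(\<Sum>i\<in>K. D l0 i * c i) = 0" by simp
  with c show ?thesis unfolding D_def by blast
qed

definition coord_support :: "nat \<Rightarrow> (nat \<Rightarrow> complex) \<Rightarrow> nat set" where
  "coord_support n x = {l\<in>{1..n}. x l \<noteq> 0}"

text \<open>
  The data \<open>(I, K, \<mu>, \<mu>')\<close> record a possible support of the zero, the forms that vanish there, and
  for each of them two terms that are comparable at the zero. There are finitely many such data, and
  each that admits a linear relation as in \<open>linear_relation_of_monomial_differences\<close> gets one such
  relation, independently of the point. This makes the choice of the logarithmic coefficients \<open>v\<close>
  possible before any zero is known.
\<close>

lemma exists_general_forms:
  fixes \<Omega> :: "nat set" and d b :: "nat \<Rightarrow> nat"
  assumes pos: "\<forall>i\<in>{1..n}. b i > 0" and fin: "finite \<Omega>"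
  shows "\<exists>F. (\<forall>i\<in>\<Omega>. F i \<in> forms n b (d i) \<and> (monoms n b (d i) \<noteq> {} \<longrightarrow> F i \<noteq> 0)) \<and>
    (\<forall>x. coord_support n x \<noteq> {} \<longrightarrow>
      card {i\<in>\<Omega>. (\<exists>m\<in>monoms n b (d i). Poly_Mapping.keys m \<subseteq> coord_support n x) \<and> eval_mpoly x (F i) = 0}
        < card (coord_support n x))"
proof -
  let ?lk = Poly_Mapping.lookup
  define M where "M = (\<lambda>i. monoms n b (d i))"
  have finM: "finite (M i)" for i using finite_monoms_card[OF pos] by (simp add: M_def)
  define S where "S = Sigma \<Omega> M"
  have finS: "finite S" using fin finM by (simp add: S_def)
  define rel where "rel = (\<lambda>(I :: nat set, K :: nat set, \<mu>, \<mu>') c. (\<exists>i\<in>K. c i \<noteq> (0::real)) \<and>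
      (\<forall>l\<in>I. (\<Sum>i\<in>K. (real (?lk (\<mu> i) l) - real (?lk (\<mu>' i) l)) * c i) = 0))"
  define \<Theta> where "\<Theta> = {(I, K, \<mu>, \<mu>'). I \<subseteq> {1..n} \<and> K \<subseteq> \<Omega> \<and> \<mu> \<in> PiE K M \<and> \<mu>' \<in> PiE K M \<and>
      (\<forall>i\<in>K. \<mu> i \<noteq> \<mu>' i) \<and> (\<exists>c. rel (I, K, \<mu>, \<mu>') c)}"
  have "\<Theta> \<subseteq> Pow {1..n} \<times> (SIGMA K:Pow \<Omega>. PiE K M \<times> PiE K M)"
    by (auto simp: \<Theta>_def)
  moreover have "finite (Pow {1..n} \<times> (SIGMA K:Pow \<Omega>. PiE K M \<times> PiE K M))"
    using fin finM by (intro finite_cartesian_product finite_SigmaI finite_PiE)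
      (auto intro: finite_subset[OF _ fin])
  ultimately have fin\<Theta>: "finite \<Theta>" by (rule finite_subset)
  define c where "c = (\<lambda>\<theta>. SOME c. rel \<theta> c)"
  have c: "rel \<theta> (c \<theta>)" if "\<theta> \<in> \<Theta>" for \<theta>
    using that unfolding c_def by (intro someI_ex[of "rel \<theta>"]) (auto simp: \<Theta>_def)
  \<comment> \<open>The relation of \<open>\<theta>\<close>, applied to the differences \<open>v (i, \<mu> i) - v (i, \<mu>' i)\<close>, as a linear form in \<open>v\<close>.\<close>
  define \<phi> where "\<phi> = (\<lambda>\<theta>. \<lambda>(i, m). case \<theta> of (I :: nat set, K, \<mu>, \<mu>') \<Rightarrow>
     if i \<in> K then (if m = \<mu> i then c \<theta> i else 0) - (if m = \<mu>' i then c \<theta> i else 0) else 0)"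
  define \<beta> where "\<beta> = (\<lambda>\<theta>. case \<theta> of (I :: nat set, K, \<mu> :: nat \<Rightarrow> nat \<Rightarrow>\<^sub>0 nat, \<mu>' :: nat \<Rightarrow> nat \<Rightarrow>\<^sub>0 nat) \<Rightarrow>
     (\<Sum>i\<in>K. \<bar>c \<theta> i\<bar> * ln (real (card (M i)))))"
  have nz: "\<exists>s\<in>S. \<phi> \<theta> s \<noteq> 0" if in\<Theta>: "\<theta> \<in> \<Theta>" for \<theta>
  proof -
    obtain I K \<mu> \<mu>' where \<theta>: "\<theta> = (I, K, \<mu>, \<mu>')" by (cases \<theta>)
    obtain i where i: "i \<in> K" "c \<theta> i \<noteq> 0" using c[OF in\<Theta>] by (auto simp: rel_def \<theta>)
    then have "(i, \<mu> i) \<in> S" using in\<Theta> by (auto simp: \<Theta>_def \<theta> S_def)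
    moreover have "\<phi> \<theta> (i, \<mu> i) \<noteq> 0" using i in\<Theta> by (auto simp: \<Theta>_def \<theta> \<phi>_def)
    ultimately show ?thesis by blast
  qed
  obtain v where v: "\<And>\<theta>. \<theta> \<in> \<Theta> \<Longrightarrow> \<beta> \<theta> < \<bar>\<Sum>s\<in>S. \<phi> \<theta> s * v s\<bar>"
    using exists_vector_large_on_forms[where \<beta> = \<beta> and \<phi> = \<phi>, OF finS fin\<Theta> nz] by blast
  define F where "F = (\<lambda>i. \<Sum>m\<in>M i. Poly_Mapping.single m (complex_of_real (exp (v (i, m)))))"
  have lkF: "?lk (F i) m = (if m \<in> M i then complex_of_real (exp (v (i, m))) else 0)" for i m
  proof -
    have "?lk (F i) m = (\<Sum>k\<in>M i. if k = m then complex_of_real (exp (v (i, k))) else 0)"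
      unfolding F_def lookup_sum by (intro sum.cong) (auto simp: lookup_single when_def)
    then show ?thesis using finM by simp
  qed
  have keysF: "Poly_Mapping.keys (F i) = M i" for i by (auto simp: in_keys_iff lkF split: if_splits)
  have F: "F i \<in> forms n b (d i) \<and> (monoms n b (d i) \<noteq> {} \<longrightarrow> F i \<noteq> 0)" for i
    using keysF[of i] by (auto simp: forms_def M_def)
  have few: "card {i\<in>\<Omega>. (\<exists>m\<in>M i. Poly_Mapping.keys m \<subseteq> coord_support n x) \<and> eval_mpoly x (F i) = 0}
      < card (coord_support n x)" if I: "coord_support n x \<noteq> {}" for x
  proof (rule ccontr)
    define I where "I = coord_support n x"
    define K where "K = {i\<in>\<Omega>. (\<exists>m\<in>M i. Poly_Mapping.keys m \<subseteq> I) \<and> eval_mpoly x (F i) = 0}"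
    assume "\<not> ?thesis"
    then have card: "card I \<le> card K" by (simp add: I_def K_def)
    have "I \<subseteq> {1..n}" by (auto simp: I_def coord_support_def)
    have "finite I" using \<open>I \<subseteq> _\<close> finite_subset by blast
    have "K \<subseteq> \<Omega>" by (auto simp: K_def)
    have "finite K" using fin by (simp add: K_def)
    have xI: "x l \<noteq> 0" if "l \<in> I" for l using that by (auto simp: I_def coord_support_def)
    define u where "u = (\<lambda>l. ln (norm (x l)))"
    \<comment> \<open>The logarithm of the absolute value of the term of \<open>F i\<close> at the monomial \<open>m\<close>.\<close>
    define val where "val = (\<lambda>i m. v (i, m) + (\<Sum>l\<in>I. real (?lk m l) * u l))"
    have term_nz: "eval_monomial x m \<noteq> 0 \<longleftrightarrow> Poly_Mapping.keys m \<subseteq> I" if "m \<in> M i" for m i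
    proof -
      have "Poly_Mapping.keys m \<subseteq> {1..n}" using that by (auto simp: M_def monoms_def)
      then show ?thesis by (auto simp: eval_monomial_def I_def coord_support_def in_keys_iff)
    qed
    have norm_term: "norm (complex_of_real (exp (v (i, m))) * eval_monomial x m) = exp (val i m)"
      if "Poly_Mapping.keys m \<subseteq> I" for i m
    proof -
      have "norm (eval_monomial x m) = (\<Prod>l\<in>Poly_Mapping.keys m. norm (x l) ^ ?lk m l)"
        by (simp add: eval_monomial_def norm_power flip: prod_norm)
      also have "\<dots> = (\<Prod>l\<in>I. norm (x l) ^ ?lk m l)"
        using that \<open>finite I\<close> by (intro prod.mono_neutral_left) (auto simp: in_keys_iff)
      also have "\<dots> = (\<Prod>l\<in>I. exp (real (?lk m l) * u l))"
        using xI by (intro prod.cong) (auto simp: u_def exp_of_nat_mult)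
      finally show ?thesis
        using \<open>finite I\<close> by (simp add: norm_mult val_def exp_add exp_sum)
    qed
    have "\<exists>m m'. m \<in> M i \<and> m' \<in> M i \<and> m \<noteq> m' \<and> Poly_Mapping.keys m \<subseteq> I \<and> Poly_Mapping.keys m' \<subseteq> I \<and>
        \<bar>val i m - val i m'\<bar> \<le> ln (real (card (M i)))" if "i \<in> K" for i
    proof -
      let ?z = "\<lambda>m. complex_of_real (exp (v (i, m))) * eval_monomial x m"
      obtain m0 where m0: "m0 \<in> M i" "Poly_Mapping.keys m0 \<subseteq> I" using \<open>i \<in> K\<close> by (auto simp: K_def)
      have "(\<Sum>m\<in>M i. ?z m) = eval_mpoly x (F i)"
        by (simp add: eval_mpoly_def keysF lkF)
      also have "\<dots> = 0" using \<open>i \<in> K\<close> by (simp add: K_def)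
      finally obtain m m' where m: "m \<in> M i" "m' \<in> M i" "m \<noteq> m'" "?z m \<noteq> 0" "?z m' \<noteq> 0"
        "norm (?z m') \<le> norm (?z m)" "norm (?z m) \<le> real (card (M i)) * norm (?z m')"
        using comparable_terms_of_zero_sum[OF finM m0(1), of ?z] term_nz[OF m0(1)] m0(2) by auto
      then have sub: "Poly_Mapping.keys m \<subseteq> I" "Poly_Mapping.keys m' \<subseteq> I" using term_nz by auto
      have pos: "0 < card (M i)" using finM m0(1) by (auto simp: card_gt_0_iff)
      have "exp (val i m') \<le> exp (val i m)" using m(6) by (simp only: norm_term sub)
      moreover have "exp (val i m) \<le> exp (ln (real (card (M i))) + val i m')"
        using m(7) pos by (simp only: norm_term sub exp_add) simp
      ultimately have "\<bar>val i m - val i m'\<bar> \<le> ln (real (card (M i)))" by simp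
      with m sub show ?thesis by blast
    qed
    then obtain \<mu>0 \<mu>0' where \<mu>0: "\<And>i. i \<in> K \<Longrightarrow> \<mu>0 i \<in> M i \<and> \<mu>0' i \<in> M i \<and> \<mu>0 i \<noteq> \<mu>0' i \<and>
        Poly_Mapping.keys (\<mu>0 i) \<subseteq> I \<and> Poly_Mapping.keys (\<mu>0' i) \<subseteq> I \<and>
        \<bar>val i (\<mu>0 i) - val i (\<mu>0' i)\<bar> \<le> ln (real (card (M i)))" by metis
    \<comment> \<open>Restriction to \<open>K\<close> makes the choice of monomials one of the finitely many data.\<close>
    define \<mu> \<mu>' where "\<mu> = restrict \<mu>0 K" "\<mu>' = restrict \<mu>0' K"
    have \<mu>: "\<mu> i \<in> M i" "\<mu>' i \<in> M i" "\<mu> i \<noteq> \<mu>' i" "Poly_Mapping.keys (\<mu> i) \<subseteq> I" "Poly_Mapping.keys (\<mu>' i) \<subseteq> I"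
        "\<bar>val i (\<mu> i) - val i (\<mu>' i)\<bar> \<le> ln (real (card (M i)))" if "i \<in> K" for i
      using \<mu>0[OF that] that by (auto simp: \<mu>_\<mu>'_def)
    define \<theta> where "\<theta> = (I, K, \<mu>, \<mu>')"
    have "\<exists>c. rel \<theta> c"
      using linear_relation_of_monomial_differences[OF pos \<open>I \<subseteq> _\<close> _ \<open>finite K\<close> card, of \<mu> d \<mu>'] \<mu> I
      by (auto simp: rel_def \<theta>_def I_def M_def)
    then have \<theta>: "\<theta> \<in> \<Theta>"
      using \<open>I \<subseteq> _\<close> \<mu> by (auto simp: \<Theta>_def \<theta>_def K_def \<mu>_\<mu>'_def)
    have rel: "(\<Sum>i\<in>K. (real (?lk (\<mu> i) l) - real (?lk (\<mu>' i) l)) * c \<theta> i) = 0" if "l \<in> I" for l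
      using c[OF \<theta>] that by (auto simp: rel_def \<theta>_def)
    have "(\<Sum>s\<in>S. \<phi> \<theta> s * v s) = (\<Sum>i\<in>\<Omega>. \<Sum>m\<in>M i. \<phi> \<theta> (i, m) * v (i, m))"
      unfolding S_def using fin finM by (subst sum.Sigma) auto
    also have "\<dots> = (\<Sum>i\<in>K. \<Sum>m\<in>M i. \<phi> \<theta> (i, m) * v (i, m))"
      using fin \<open>K \<subseteq> \<Omega>\<close> by (intro sum.mono_neutral_right) (auto simp: \<phi>_def \<theta>_def)
    also have "\<dots> = (\<Sum>i\<in>K. c \<theta> i * (v (i, \<mu> i) - v (i, \<mu>' i)))"
    proof (rule sum.cong)
      fix i assume i: "i \<in> K"
      have "(\<Sum>m\<in>M i. \<phi> \<theta> (i, m) * v (i, m)) =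
          (\<Sum>m\<in>M i. (if m = \<mu> i then c \<theta> i * v (i, m) else 0) - (if m = \<mu>' i then c \<theta> i * v (i, m) else 0))"
        using i by (intro sum.cong) (auto simp: \<phi>_def \<theta>_def)
      also have "\<dots> = c \<theta> i * (v (i, \<mu> i) - v (i, \<mu>' i))"
        using \<mu>[OF i] finM by (simp add: sum_subtractf right_diff_distrib)
      finally show "(\<Sum>m\<in>M i. \<phi> \<theta> (i, m) * v (i, m)) = c \<theta> i * (v (i, \<mu> i) - v (i, \<mu>' i))" .
    qed simp
    also have "\<dots> = (\<Sum>i\<in>K. c \<theta> i * (val i (\<mu> i) - val i (\<mu>' i)))
        - (\<Sum>i\<in>K. c \<theta> i * (\<Sum>l\<in>I. (real (?lk (\<mu> i) l) - real (?lk (\<mu>' i) l)) * u l))"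
      by (simp add: val_def left_diff_distrib sum_subtractf right_diff_distrib sum.distrib distrib_left)
    also have "(\<Sum>i\<in>K. c \<theta> i * (\<Sum>l\<in>I. (real (?lk (\<mu> i) l) - real (?lk (\<mu>' i) l)) * u l))
        = (\<Sum>l\<in>I. u l * (\<Sum>i\<in>K. (real (?lk (\<mu> i) l) - real (?lk (\<mu>' i) l)) * c \<theta> i))"
      unfolding sum_distrib_left by (subst sum.swap) (simp add: mult_ac)
    also have "\<dots> = 0" using rel by simp
    finally have "\<bar>\<Sum>s\<in>S. \<phi> \<theta> s * v s\<bar> = \<bar>\<Sum>i\<in>K. c \<theta> i * (val i (\<mu> i) - val i (\<mu>' i))\<bar>" by simp
    also have "\<dots> \<le> (\<Sum>i\<in>K. \<bar>c \<theta> i * (val i (\<mu> i) - val i (\<mu>' i))\<bar>)" by (rule sum_abs)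
    also have "\<dots> \<le> (\<Sum>i\<in>K. \<bar>c \<theta> i\<bar> * ln (real (card (M i))))"
      using \<mu>(6) by (intro sum_mono) (simp add: abs_mult mult_left_mono)
    also have "\<dots> = \<beta> \<theta>" by (simp add: \<beta>_def \<theta>_def)
    finally show False using v[OF \<theta>] by simp
  qed
  show ?thesis using F few unfolding M_def by blast
qed

section \<open>Hilbert series of complete intersections\<close>

lemma Ideal_image_insert:
  assumes "F i \<in> polys n" "\<And>j. j \<in> S \<Longrightarrow> F j \<in> polys n"
  shows "Ideal n (F ` insert i S) = ideal_insert n (F i) (Ideal n (F ` S))"
  unfolding image_insert using assms by (intro Ideal_insert) auto

text \<open>
  The family \<open>F\<close> on \<open>S\<close> of forms of degrees \<open>e\<close> generates an ideal with the Hilbert series of a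
  complete intersection, at the one argument \<open>t\<close>. The lemmas below show that for positive degrees
  this is regularity of the family, in a formulation that does not see the order of its members.
\<close>

definition has_ci_series :: "nat \<Rightarrow> (nat \<Rightarrow> nat) \<Rightarrow> real \<Rightarrow> (nat \<Rightarrow> mpoly) \<Rightarrow> (nat \<Rightarrow> nat) \<Rightarrow> nat set \<Rightarrow> bool" where
  "has_ci_series n b t F e S \<longleftrightarrow>
    hilbert_series n b t (Ideal n (F ` S)) = (\<Prod>i\<in>S. 1 - t ^ e i) * hilbert_series n b t {0}"

context
  fixes n :: nat and b :: "nat \<Rightarrow> nat" and t :: real and F :: "nat \<Rightarrow> mpoly" and e :: "nat \<Rightarrow> nat"
  assumes pos: "\<forall>i\<in>{1..n}. b i > 0" and t: "0 < t" "t < 1"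
begin

text \<open>
  The constants make the coefficient in degree 0 non-zero.
\<close>

lemma hilbert_series_zero_pos: "0 < hilbert_series n b t {0}"
proof -
  have "hilbert_fun n b {0} 0 \<noteq> 0"
  proof
    assume eq: "hilbert_fun n b {0} 0 = 0"
    have "ideal {0} (mpoly_ring n)" by (rule ideal_mpoly_ringI) auto
    moreover have "polys n \<inter> forms n b 0 = forms n b 0" using forms_subset_polys by blast
    then have "hilbert_fun n b (polys n) 0 = hilbert_fun n b {0} 0" using eq by (simp add: hilbert_fun_def)
    ultimately have "{0} \<inter> forms n b 0 = polys n \<inter> forms n b 0"
      by (intro hilbert_fun_eqD[OF pos]) auto
    moreover have "1 \<in> polys n \<inter> forms n b 0" using forms_one[of n b] by simp
    ultimately have "(1 :: mpoly) \<in> {0}" by blast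
    then show False by simp
  qed
  then have "0 < hilbert_fun n b {0} 0 * t ^ 0" using hilbert_fun_nonneg[OF pos, of "{0}" 0] by simp
  then show ?thesis
    unfolding hilbert_series_def
    using t hilbert_fun_nonneg[OF pos] by (intro suminf_pos2[OF summable_hilbert_fun[OF pos t], where i = 0]) auto
qed

lemma hilbert_series_Ideal_ge:
  assumes "finite S" "\<And>i. i \<in> S \<Longrightarrow> F i \<in> forms n b (e i)"
  shows "(\<Prod>i\<in>S. 1 - t ^ e i) * hilbert_series n b t {0} \<le> hilbert_series n b t (Ideal n (F ` S))"
  using assms
proof (induction S rule: finite_induct)
  case empty
  then show ?case by (simp add: Ideal_empty)
next
  case (insert i S)
  have "0 \<le> 1 - t ^ e i" using t by (simp add: power_le_one)
  then have "(1 - t ^ e i) * ((\<Prod>i\<in>S. 1 - t ^ e i) * hilbert_series n b t {0}) \<le>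
      (1 - t ^ e i) * hilbert_series n b t (Ideal n (F ` S))"
    using insert.IH insert.prems by (intro mult_left_mono) auto
  also have "\<dots> \<le> hilbert_series n b t (ideal_insert n (F i) (Ideal n (F ` S)))"
    using insert by (intro hilbert_series_ideal_insert_ge[OF pos t] graded_ideal_Ideal[where d = e]) auto
  also have "ideal_insert n (F i) (Ideal n (F ` S)) = Ideal n (F ` insert i S)"
    using insert.prems forms_subset_polys by (intro Ideal_image_insert[symmetric]) blast+
  finally show ?case using insert.hyps by (simp add: mult.assoc)
qed

text \<open>
  The lower bound for the enlarged family factors through the one for \<open>S\<close>, so it is attained if and
  only if both steps are equalities.
\<close>

lemma has_ci_series_insert_iff:
  assumes "finite S" "i \<notin> S" "e i > 0" "\<And>j. j \<in> insert i S \<Longrightarrow> F j \<in> forms n b (e j)"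
  shows "has_ci_series n b t F e (insert i S) \<longleftrightarrow>
    has_ci_series n b t F e S \<and> (\<forall>u\<in>polys n. u * F i \<in> Ideal n (F ` S) \<longrightarrow> u \<in> Ideal n (F ` S))"
proof -
  let ?H = "hilbert_series n b t" and ?J = "Ideal n (F ` S)"
  have gr: "graded_ideal n b ?J" using assms by (intro graded_ideal_Ideal[where d = e]) auto
  have Fi: "F i \<in> forms n b (e i)" using assms(4) by simp
  have ins: "Ideal n (F ` insert i S) = ideal_insert n (F i) ?J"
    using assms(4) forms_subset_polys by (intro Ideal_image_insert) blast+
  have p: "0 < 1 - t ^ e i" using t assms(3) by (simp add: power_Suc_less_one power_less_one_iff)
  have le1: "(1 - t ^ e i) * ?H ?J \<le> ?H (ideal_insert n (F i) ?J)"
    by (rule hilbert_series_ideal_insert_ge[OF pos t gr Fi])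
  have le2: "(\<Prod>i\<in>S. 1 - t ^ e i) * ?H {0} \<le> ?H ?J"
    using assms by (intro hilbert_series_Ideal_ge) auto
  have "?H (ideal_insert n (F i) ?J) = (1 - t ^ e i) * ((\<Prod>i\<in>S. 1 - t ^ e i) * ?H {0}) \<longleftrightarrow>
     ?H ?J = (\<Prod>i\<in>S. 1 - t ^ e i) * ?H {0} \<and> ?H (ideal_insert n (F i) ?J) = (1 - t ^ e i) * ?H ?J"
    (is "?L \<longleftrightarrow> ?R")
  proof
    assume L: ?L
    have "?H ?J \<le> (\<Prod>i\<in>S. 1 - t ^ e i) * ?H {0}"
      using le1 p unfolding L by (simp only: mult_le_cancel_left_pos)
    with le2 have "?H ?J = (\<Prod>i\<in>S. 1 - t ^ e i) * ?H {0}" by (rule antisym[rotated])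
    with L show ?R by simp
  qed simp
  then show ?thesis
    using assms(1,2) hilbert_series_ideal_insert_eq_iff[OF pos t gr Fi]
    unfolding has_ci_series_def ins by (simp add: mult.assoc)
qed

lemma has_ci_series_subset:
  assumes "finite S" "has_ci_series n b t F e S" "T \<subseteq> S"
    "\<And>i. i \<in> S \<Longrightarrow> F i \<in> forms n b (e i) \<and> e i > 0"
  shows "has_ci_series n b t F e T"
proof -
  have "has_ci_series n b t F e T" if "finite D" "has_ci_series n b t F e (D \<union> T)" "D \<inter> T = {}" "D \<union> T \<subseteq> S" for D
    using that
  proof (induction D rule: finite_induct)
    case (insert i D)
    have "has_ci_series n b t F e (insert i (D \<union> T))" using insert.prems by simp
    moreover have "finite (D \<union> T)" using insert.prems assms(1) by (blast intro: finite_subset)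
    ultimately have "has_ci_series n b t F e (D \<union> T)"
      using has_ci_series_insert_iff[of "D \<union> T" i] insert.hyps insert.prems assms(4) by auto
    then show ?case using insert.IH insert.prems by blast
  qed simp
  moreover have "(S - T) \<union> T = S" "(S - T) \<inter> T = {}" using assms(3) by blast+
  ultimately show ?thesis using assms(1,2) by (metis finite_Diff order_refl)
qed

text \<open>
  Suppose \<open>u \<cdot> F inn\<close> lies in the ideal of \<open>L\<close>. Since \<open>F inn\<close> divides a power of \<open>F out\<close> modulo that
  ideal, so does \<open>u\<close> times this power, and the non-zero-divisor \<open>F out\<close> can be cancelled.
\<close>

lemma has_ci_series_exchange:
  assumes "finite L" "out \<notin> L" "inn \<notin> L" "e out > 0" "e inn > 0"
    and F: "\<And>i. i \<in> insert out (insert inn L) \<Longrightarrow> F i \<in> forms n b (e i)"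
    and ci: "has_ci_series n b t F e (insert out L)"
    and pow: "F out ^ k \<in> Ideal n (F ` insert inn L)"
  shows "has_ci_series n b t F e (insert inn L)"
proof -
  let ?J = "Ideal n (F ` L)"
  have J: "ideal ?J (mpoly_ring n)"
    using F forms_subset_polys by (intro ideal_Ideal) blast
  have polys: "F out \<in> polys n" "F inn \<in> polys n" using F forms_subset_polys by blast+
  have nzd: "\<forall>u\<in>polys n. u * F out \<in> ?J \<longrightarrow> u \<in> ?J" and ciL: "has_ci_series n b t F e L"
    using ci has_ci_series_insert_iff[of L out] assms(1,2,4) F by auto
  have "F out ^ k \<in> ideal_insert n (F inn) ?J"
    using pow Ideal_image_insert[of F inn n L] F forms_subset_polys by (metis insertCI)
  then obtain p q where pq: "F out ^ k = p + q * F inn" "p \<in> ?J" "q \<in> polys n"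
    by (auto simp: ideal_insert_def)
  have cancel: "u \<in> polys n \<Longrightarrow> u * F out ^ j \<in> ?J \<Longrightarrow> u \<in> ?J" for u j
  proof (induction j arbitrary: u)
    case (Suc j)
    then have "(u * F out) * F out ^ j \<in> ?J" by (simp add: mult.assoc)
    with Suc polys have "u * F out \<in> ?J" by simp
    with nzd Suc.prems show ?case by blast
  qed simp
  have "u \<in> ?J" if u: "u \<in> polys n" "u * F inn \<in> ?J" for u
  proof -
    have "u * p + q * (u * F inn) \<in> ?J"
      by (rule ideal_add[OF J ideal_mult[OF J pq(2) u(1)] ideal_mult[OF J u(2) pq(3)]])
    also have "u * p + q * (u * F inn) = u * F out ^ k" by (simp add: pq(1) algebra_simps)
    finally show ?thesis by (rule cancel[OF u(1)])
  qed
  with ciL show ?thesis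
    using has_ci_series_insert_iff[of L inn] assms(1,3,5) F by auto
qed

end

section \<open>Ideals of variables, semigroups and quotient rings\<close>

lemma lookup_mult_monomial:
  "Poly_Mapping.lookup (u * Poly_Mapping.single k 1) (m + k) = Poly_Mapping.lookup (u :: mpoly) m"
proof -
  have "u * Poly_Mapping.single k 1 =
      (\<Sum>m\<in>Poly_Mapping.keys u. Poly_Mapping.single m (Poly_Mapping.lookup u m)) * Poly_Mapping.single k 1"
    using mpoly_eq_sum_monomials[of "Poly_Mapping.keys u" u] by simp
  also have "\<dots> = (\<Sum>m\<in>Poly_Mapping.keys u. Poly_Mapping.single (m + k) (Poly_Mapping.lookup u m))"
    by (simp add: sum_distrib_right mult_single)
  finally have "Poly_Mapping.lookup (u * Poly_Mapping.single k 1) (m + k) =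
      (\<Sum>m'\<in>Poly_Mapping.keys u. if m' = m then Poly_Mapping.lookup u m' else 0)"
    by (simp add: lookup_sum lookup_single when_def)
  then show ?thesis by (simp add: in_keys_iff)
qed

text \<open>
  Both directions of the theorem compare ideals with ideals of variables, in which membership is
  read off from the monomials.
\<close>

lemma Ideal_vars:
  assumes "S \<subseteq> {1..n}"
  shows "Ideal n (var ` S) = {p \<in> polys n. \<forall>m\<in>Poly_Mapping.keys p. Poly_Mapping.keys m \<inter> S \<noteq> {}}"
    (is "_ = ?M")
proof
  have vars: "var ` S \<subseteq> polys n" using assms by auto
  have J: "ideal (Ideal n (var ` S)) (mpoly_ring n)" by (rule ideal_Ideal[OF vars])
  show "Ideal n (var ` S) \<subseteq> ?M"
  proof (rule Ideal_minimal)
    show "ideal ?M (mpoly_ring n)"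
    proof (rule ideal_mpoly_ringI)
      fix p q assume "p \<in> ?M" "q \<in> ?M"
      then show "p + q \<in> ?M" using keys_add[of p q] by auto
    next
      fix p r assume p: "p \<in> ?M" and r: "r \<in> polys n"
      have "Poly_Mapping.keys m \<inter> S \<noteq> {}" if "m \<in> Poly_Mapping.keys (r * p)" for m
      proof -
        obtain s k where sk: "k \<in> Poly_Mapping.keys p" "m = s + k"
          using keys_mult[of r p] \<open>m \<in> _\<close> by blast
        then have "Poly_Mapping.keys k \<subseteq> Poly_Mapping.keys m" by (auto simp: in_keys_iff lookup_add)
        then show ?thesis using p sk(1) by blast
      qed
      then show "r * p \<in> ?M" using p r by auto
    qed auto
    show "var ` S \<subseteq> ?M" using vars by (auto simp: var_def)
  qed
  show "?M \<subseteq> Ideal n (var ` S)"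
  proof
    fix p assume p: "p \<in> ?M"
    have "Poly_Mapping.single m (Poly_Mapping.lookup p m) \<in> Ideal n (var ` S)"
      if m: "m \<in> Poly_Mapping.keys p" for m
    proof -
      obtain j where j: "j \<in> Poly_Mapping.keys m" "j \<in> S" using p m by blast
      define k where "k = m - Poly_Mapping.single j 1"
      have mk: "m = k + Poly_Mapping.single j 1"
        using j(1) by (intro poly_mapping_eqI)
          (auto simp: k_def lookup_add lookup_minus lookup_single when_def in_keys_iff)
      have "Poly_Mapping.keys k \<subseteq> Poly_Mapping.keys m"
        by (auto simp: k_def in_keys_iff lookup_minus)
      also have "Poly_Mapping.keys m \<subseteq> {1..n}" using p m by (auto simp: polys_iff)
      finally have "Poly_Mapping.single k (Poly_Mapping.lookup p m) \<in> polys n" by (auto simp: polys_iff)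
      moreover have "var j \<in> Ideal n (var ` S)" using Ideal_self[OF vars] j(2) by blast
      ultimately have "Poly_Mapping.single k (Poly_Mapping.lookup p m) * var j \<in> Ideal n (var ` S)"
        by (intro ideal_mult[OF J])
      also have "Poly_Mapping.single k (Poly_Mapping.lookup p m) * var j = Poly_Mapping.single m (Poly_Mapping.lookup p m)"
        by (subst (2) mk) (simp add: var_def mult_single)
      finally show ?thesis .
    qed
    then have "(\<Sum>m\<in>Poly_Mapping.keys p. Poly_Mapping.single m (Poly_Mapping.lookup p m)) \<in> Ideal n (var ` S)"
      by (rule ideal_sum[OF J])
    then show "p \<in> Ideal n (var ` S)"
      using mpoly_eq_sum_monomials[of "Poly_Mapping.keys p" p] by simp
  qed
qed

lemma var_nonzerodivisor:
  assumes "S \<subseteq> {1..n}" "i \<in> {1..n}" "i \<notin> S" "u \<in> polys n" "u * var i \<in> Ideal n (var ` S)"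
  shows "u \<in> Ideal n (var ` S)"
proof -
  have "Poly_Mapping.keys m \<inter> S \<noteq> {}" if "m \<in> Poly_Mapping.keys u" for m
  proof -
    have "m + Poly_Mapping.single i 1 \<in> Poly_Mapping.keys (u * var i)"
      using that by (simp add: in_keys_iff var_def lookup_mult_monomial del: One_nat_def)
    then have "Poly_Mapping.keys (m + Poly_Mapping.single i 1) \<inter> S \<noteq> {}"
      using assms(5) unfolding Ideal_vars[OF assms(1)] by blast
    then show ?thesis
      using keys_add[of m "Poly_Mapping.single i 1"] assms(3) by auto
  qed
  then show ?thesis using assms(4) unfolding Ideal_vars[OF assms(1)] by blast
qed

text \<open>
  A monomial in the variables of \<open>I\<close> is a choice of multiplicities of the generators. The two sides
  differ only in that several variables can have the same weight: one of them then carries the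
  whole multiplicity, or the exponents of all of them are added.
\<close>

lemma semigroup_gen_iff_monomial:
  assumes "I \<subseteq> {1..n}"
  shows "d \<in> semigroup_gen (set_mset (indexed_mset b I)) \<longleftrightarrow> (\<exists>m\<in>monoms n b d. Poly_Mapping.keys m \<subseteq> I)"
proof -
  have fin: "finite I" using assms finite_subset by blast
  then have set: "set_mset (indexed_mset b I) = b ` I" by (simp add: indexed_mset_def)
  show ?thesis
  proof
    assume "d \<in> semigroup_gen (set_mset (indexed_mset b I))"
    then obtain c where c: "d = (\<Sum>s\<in>b ` I. c s * s)" by (auto simp: semigroup_gen_def set)
    define r where "r = inv_into I b"
    have r: "r s \<in> I" "b (r s) = s" if "s \<in> b ` I" for s
      using that by (auto simp: r_def inv_into_into f_inv_into_f)
    have inj: "inj_on r (b ` I)" by (metis inj_onI r(2))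
    \<comment> \<open>The representative \<open>r s\<close> among the variables of weight \<open>s\<close> carries the whole multiplicity.\<close>
    define g where "g = (\<lambda>i. if i \<in> r ` b ` I then c (b i) else 0)"
    have fing: "finite {i. g i \<noteq> 0}" using fin by (rule finite_subset[rotated, OF finite_imageI[OF finite_imageI]]) (auto simp: g_def)
    define m where "m = Abs_poly_mapping g"
    have lk: "Poly_Mapping.lookup m = g" using fing by (simp add: m_def)
    have keys: "Poly_Mapping.keys m \<subseteq> I" using r(1) by (auto simp: in_keys_iff lk g_def split: if_splits)
    have "monomial_degree b m = (\<Sum>i\<in>I. g i * b i)"
      using monomial_degree_superset[OF fin keys] by (simp add: lk)
    also have "\<dots> = (\<Sum>i\<in>r ` b ` I. c (b i) * b i)"
      using r(1) fin by (intro sum.mono_neutral_cong_right) (auto simp: g_def)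
    also have "\<dots> = (\<Sum>s\<in>b ` I. c s * s)"
      using inj r(2) by (simp add: sum.reindex)
    finally show "\<exists>m\<in>monoms n b d. Poly_Mapping.keys m \<subseteq> I"
      using keys assms c by (intro bexI[of _ m]) (auto simp: monoms_def)
  next
    assume "\<exists>m\<in>monoms n b d. Poly_Mapping.keys m \<subseteq> I"
    then obtain m where m: "monomial_degree b m = d" "Poly_Mapping.keys m \<subseteq> I" by (auto simp: monoms_def)
    have "d = (\<Sum>i\<in>I. Poly_Mapping.lookup m i * b i)"
      using monomial_degree_superset[OF fin m(2)] m(1) by metis
    also have "\<dots> = (\<Sum>s\<in>b ` I. \<Sum>i | i \<in> I \<and> b i = s. Poly_Mapping.lookup m i * b i)"
      by (rule sum.image_gen[OF fin])
    also have "\<dots> = (\<Sum>s\<in>b ` I. (\<Sum>i | i \<in> I \<and> b i = s. Poly_Mapping.lookup m i) * s)"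
      by (simp add: sum_distrib_right)
    finally show "d \<in> semigroup_gen (set_mset (indexed_mset b I))"
      unfolding semigroup_gen_def set
      by (intro CollectI exI[of _ "\<lambda>s. \<Sum>i | i \<in> I \<and> b i = s. Poly_Mapping.lookup m i"] conjI TrueI)
  qed
qed

lemma size_mset_inter_set: 
  "finite N \<Longrightarrow> size (mset_inter_set (indexed_mset a N) T) = card {i\<in>N. a i \<in> T}"
  by (simp add: mset_inter_set_def indexed_mset_def filter_mset_image_mset)

lemma regular_sequence_iff:
  "regular_sequence (mpoly_ring n) m f \<longleftrightarrow> (\<forall>i\<in>{1..m}. f i \<in> polys n) \<and>
    (\<forall>i\<in>{1..m}. \<forall>u\<in>polys n. u * f i \<in> Ideal n (f ` {1..<i}) \<longrightarrow> u \<in> Ideal n (f ` {1..<i}))"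
proof -
  have "zero_divisor (mpoly_ring n Quot J) (J +>\<^bsub>mpoly_ring n\<^esub> g) \<longleftrightarrow>
      (\<exists>u\<in>polys n. u * g \<in> J \<and> u \<notin> J)" if J: "ideal J (mpoly_ring n)" and g: "g \<in> polys n" for J g
  proof -
    interpret ideal J "mpoly_ring n" by (rule J)
    have zero: "J +>\<^bsub>mpoly_ring n\<^esub> u = J \<longleftrightarrow> u \<in> J" if "u \<in> polys n" for u
      using a_rcos_self[OF that] a_coset_join2[OF that a_subgroup] a_rcos_const by metis
    have mult: "rcoset_mult (mpoly_ring n) J (J +>\<^bsub>mpoly_ring n\<^esub> g) (J +>\<^bsub>mpoly_ring n\<^esub> u) =
        J +>\<^bsub>mpoly_ring n\<^esub> (u * g)" if "u \<in> polys n" for u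
      using rcoset_mult_add[OF g that] by (simp add: mult.commute)
    show ?thesis
      unfolding zero_divisor_def FactRing_def A_RCOSETS_def'
      using g zero mult by auto
  qed
  moreover have "ideal (Ideal n (f ` {1..<i})) (mpoly_ring n)"
    if "\<forall>i\<in>{1..m}. f i \<in> polys n" "i \<in> {1..m}" for i
    using that by (intro ideal_Ideal) auto
  ultimately show ?thesis
    unfolding regular_sequence_def Let_def by (smt (verit, best))
qed

section \<open>The degree criterion\<close>

text \<open>
  The left product is at least \<open>(1 - t) ^ card P\<close>, the right one at most a constant times
  \<open>(1 - t) ^ card Q\<close>; the two are compared near \<open>t = 1\<close>.
\<close>

lemma card_le_of_prod_one_minus_power_le:
  fixes P Q :: "nat set" and a b :: "nat \<Rightarrow> nat"
  assumes "finite P" "finite Q" "\<And>j. j \<in> P \<Longrightarrow> b j > 0"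
    and le: "\<And>t::real. 0 < t \<Longrightarrow> t < 1 \<Longrightarrow> (\<Prod>j\<in>P. 1 - t ^ b j) \<le> (\<Prod>i\<in>Q. 1 - t ^ a i)"
  shows "card Q \<le> card P"
proof (rule ccontr)
  assume "\<not> card Q \<le> card P"
  then have gt: "Suc (card P) \<le> card Q" by simp
  define B where "B = (\<Prod>i\<in>Q. real (a i))"
  have B: "0 \<le> B" by (simp add: B_def prod_nonneg)
  \<comment> \<open>Any \<open>t\<close> with \<open>(1 - t) * B < 1\<close> serves; the summand 2 keeps \<open>t\<close> positive when \<open>B = 0\<close>.\<close>
  define t where "t = 1 - 1 / (B + 2)"
  have t: "0 < t" "t < 1" and t': "(1 - t) * B < 1" using B by (simp_all add: t_def field_simps)
  have "(1 - t) ^ card P = (\<Prod>j\<in>P. 1 - t)" by simp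
  also have "\<dots> \<le> (\<Prod>j\<in>P. 1 - t ^ b j)"
    using t assms(3) power_decreasing[of 1 _ t] by (intro prod_mono) (auto simp: Suc_le_eq)
  also have "\<dots> \<le> (\<Prod>i\<in>Q. 1 - t ^ a i)" by (rule le[OF t])
  also have "\<dots> \<le> (\<Prod>i\<in>Q. (1 - t) * real (a i))"
  proof (rule prod_mono)
    fix i
    have "1 - t ^ a i = (1 - t) * (\<Sum>k<a i. t ^ k)" by (rule one_diff_power_eq)
    also have "\<dots> \<le> (1 - t) * (\<Sum>k<a i. 1)"
      using t by (intro mult_left_mono sum_mono) (auto simp: power_le_one)
    finally show "0 \<le> 1 - t ^ a i \<and> 1 - t ^ a i \<le> (1 - t) * real (a i)"
      using t by (simp add: power_le_one)
  qed
  also have "\<dots> = (1 - t) ^ card Q * B" by (simp add: prod.distrib B_def)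
  also have "\<dots> \<le> (1 - t) ^ Suc (card P) * B"
    using t B gt by (intro mult_right_mono power_decreasing) auto
  also have "\<dots> = (1 - t) ^ card P * ((1 - t) * B)" by simp
  also have "\<dots> < (1 - t) ^ card P * 1" using t t' by (intro mult_strict_left_mono) auto
  finally show False by simp
qed

lemma has_ci_series_of_regular_sequence:
  assumes pos: "\<forall>i\<in>{1..n}. b i > 0" and t: "0 < t" "t < 1"
    and f: "\<And>i. i \<in> {1..m} \<Longrightarrow> f i \<in> forms n b (a i) \<and> a i > 0"
    and reg: "regular_sequence (mpoly_ring n) m f" and "k \<le> m"
  shows "has_ci_series n b t f a {1..k}"
  using \<open>k \<le> m\<close>
proof (induction k)
  case 0
  then show ?case by (simp add: has_ci_series_def Ideal_empty)
next
  case (Suc k)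
  have "{1..Suc k} = insert (Suc k) {1..k}" and "{1..k} = {1..<Suc k}" by auto
  moreover have "has_ci_series n b t f a (insert (Suc k) {1..k})"
    using Suc f reg calculation(2)
    by (subst has_ci_series_insert_iff[OF pos t]) (auto simp: regular_sequence_iff)
  ultimately show ?case by simp
qed

lemma regular_sequence_of_ci_series:
  assumes pos: "\<forall>i\<in>{1..n}. b i > 0" and t: "0 < t" "t < 1"
    and f: "\<And>i. i \<in> {1..m} \<Longrightarrow> f i \<in> forms n b (a i) \<and> a i > 0"
    and ci: "has_ci_series n b t f a {1..m}"
  shows "regular_sequence (mpoly_ring n) m f"
  unfolding regular_sequence_iff
proof (intro conjI ballI impI)
  show "f i \<in> polys n" if "i \<in> {1..m}" for i using f[OF that] forms_subset_polys by blast
next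
  fix i u assume i: "i \<in> {1..m}" and u: "u \<in> polys n" "u * f i \<in> Ideal n (f ` {1..<i})"
  have sub: "insert i {1..<i} \<subseteq> {1..m}" using i by auto
  have "has_ci_series n b t f a (insert i {1..<i})"
    by (rule has_ci_series_subset[OF pos t _ ci sub]) (use f in auto)
  moreover have "f j \<in> forms n b (a j)" if "j \<in> insert i {1..<i}" for j
    using f sub that by blast
  ultimately show "u \<in> Ideal n (f ` {1..<i})"
    using has_ci_series_insert_iff[OF pos t, of "{1..<i}" i a f] f[OF i] u by simp
qed

text \<open>
  Necessity of the inequalities. The family \<open>G\<close> on \<open>S\<close> consists of the forms \<open>f i\<close> with \<open>i\<close> in \<open>K\<close>
  and, with indices shifted by \<open>n\<close>, of the variables outside \<open>I\<close>; its ideal contains all \<open>f i\<close>.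
\<close>

lemma card_bound_of_regular_sequence:
  assumes pos: "\<forall>i\<in>{1..n}. b i > 0"
    and f: "\<And>i. i \<in> {1..n} \<Longrightarrow> f i \<in> forms n b (a i) \<and> a i > 0"
    and reg: "regular_sequence (mpoly_ring n) n f" and I: "I \<subseteq> {1..n}"
  shows "card I \<le> card {i\<in>{1..n}. \<exists>m\<in>monoms n b (a i). Poly_Mapping.keys m \<subseteq> I}"
proof -
  define K where "K = {i\<in>{1..n}. \<exists>m\<in>monoms n b (a i). Poly_Mapping.keys m \<subseteq> I}"
  define C where "C = {1..n} - I"
  define G where "G = (\<lambda>i. if i \<le> n then f i else var (i - n))"
  define e where "e = (\<lambda>i. if i \<le> n then a i else b (i - n))"
  define S where "S = K \<union> (\<lambda>j. n + j) ` C"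
  have K: "K \<subseteq> {1..n}" and C: "C \<subseteq> {1..n}" by (auto simp: K_def C_def)
  have finite: "finite K" "finite C" "finite S" by (auto simp: K_def C_def S_def)
  have disj: "K \<inter> (\<lambda>j. n + j) ` C = {}" using K C by fastforce
  have G: "G i \<in> forms n b (e i)" if "i \<in> S" for i
  proof -
    from that consider "i \<in> K" | j where "j \<in> C" "i = n + j" by (auto simp: S_def)
    then show ?thesis
    proof cases
      case 1
      with K have "i \<in> {1..n}" by blast
      with f[of i] show ?thesis by (simp add: G_def e_def)
    next
      case 2
      with C have "j \<in> {1..n}" by blast
      with 2 forms_var[of j n b] show ?thesis by (simp add: G_def e_def)
    qed
  qed
  have Gpolys: "G ` S \<subseteq> polys n" using G forms_subset_polys by blast
  have J': "ideal (Ideal n (G ` S)) (mpoly_ring n)" by (rule ideal_Ideal[OF Gpolys])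
  have vars: "Ideal n (var ` C) \<subseteq> Ideal n (G ` S)"
  proof (rule Ideal_minimal[OF J'])
    have "var j \<in> G ` S" if "j \<in> C" for j
    proof -
      have "var j = G (n + j)" using that C by (auto simp: G_def)
      then show ?thesis using that by (auto simp: S_def)
    qed
    then show "var ` C \<subseteq> Ideal n (G ` S)" using Ideal_self[OF Gpolys] by blast
  qed
  have "f i \<in> Ideal n (G ` S)" if i: "i \<in> {1..n}" for i
  proof (cases "i \<in> K")
    case True
    then have "f i = G i" "i \<in> S" using i by (auto simp: G_def S_def)
    then show ?thesis using Ideal_self[OF Gpolys] by auto
  next
    case False
    have "Poly_Mapping.keys m \<inter> C \<noteq> {}" if "m \<in> Poly_Mapping.keys (f i)" for m
    proof -
      have "m \<in> monoms n b (a i)" using f[OF i] that by (auto simp: forms_def)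
      moreover from this have "\<not> Poly_Mapping.keys m \<subseteq> I" using False i by (auto simp: K_def)
      ultimately show ?thesis by (auto simp: monoms_def C_def)
    qed
    then have "f i \<in> Ideal n (var ` C)"
      unfolding Ideal_vars[OF C] using f[OF i] forms_subset_polys by blast
    with vars show ?thesis by blast
  qed
  then have sub: "Ideal n (f ` {1..n}) \<subseteq> Ideal n (G ` S)" by (intro Ideal_minimal[OF J']) auto
  have "card ({1..n} - K) \<le> card C"
  proof (rule card_le_of_prod_one_minus_power_le)
    show "b j > 0" if "j \<in> C" for j using that C pos by blast
    fix t :: real assume t: "0 < t" "t < 1"
    let ?H = "hilbert_series n b t"
    have H0: "0 < ?H {0}" by (rule hilbert_series_zero_pos[OF pos t])
    have pK: "0 < (\<Prod>i\<in>K. 1 - t ^ a i)"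
      using K f t by (intro prod_pos) (auto simp: power_less_one_iff)
    have "(\<Prod>i\<in>S. 1 - t ^ e i) = (\<Prod>i\<in>K. 1 - t ^ e i) * (\<Prod>i\<in>(\<lambda>j. n + j) ` C. 1 - t ^ e i)"
      unfolding S_def using finite disj by (intro prod.union_disjoint) auto
    also have "(\<Prod>i\<in>K. 1 - t ^ e i) = (\<Prod>i\<in>K. 1 - t ^ a i)"
      using K by (intro prod.cong) (auto simp: e_def)
    also have "(\<Prod>i\<in>(\<lambda>j. n + j) ` C. 1 - t ^ e i) = (\<Prod>j\<in>C. 1 - t ^ b j)"
      using C by (subst prod.reindex) (auto simp: e_def intro!: prod.cong)
    finally have "(\<Prod>i\<in>K. 1 - t ^ a i) * (\<Prod>j\<in>C. 1 - t ^ b j) * ?H {0} \<le> ?H (Ideal n (G ` S))"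
      using hilbert_series_Ideal_ge[OF pos t finite(3), of G e] G by simp
    also have "\<dots> \<le> ?H (Ideal n (f ` {1..n}))"
      by (rule hilbert_series_antimono[OF pos t sub])
    also have "\<dots> = (\<Prod>i\<in>{1..n}. 1 - t ^ a i) * ?H {0}"
      using has_ci_series_of_regular_sequence[OF pos t f reg order_refl] by (simp add: has_ci_series_def)
    also have "(\<Prod>i\<in>{1..n}. 1 - t ^ a i) = (\<Prod>i\<in>K. 1 - t ^ a i) * (\<Prod>i\<in>{1..n} - K. 1 - t ^ a i)"
      by (subst prod.subset_diff[OF K]) (simp_all add: mult.commute)
    finally have "(\<Prod>i\<in>K. 1 - t ^ a i) * (\<Prod>j\<in>C. 1 - t ^ b j) \<le>
        (\<Prod>i\<in>K. 1 - t ^ a i) * (\<Prod>i\<in>{1..n} - K. 1 - t ^ a i)"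
      using H0 by (simp only: mult_le_cancel_right_pos)
    then show "(\<Prod>j\<in>C. 1 - t ^ b j) \<le> (\<Prod>i\<in>{1..n} - K. 1 - t ^ a i)"
      using pK by (simp only: mult_le_cancel_left_pos)
  qed (use finite in auto)
  moreover have "card ({1..n} - K) = n - card K" "card C = n - card I" "card K \<le> n" "card I \<le> n"
    using K I card_mono[OF finite_atLeastAtMost K] card_mono[OF finite_atLeastAtMost I]
    by (auto simp: card_Diff_subset C_def finite_subset)
  ultimately show ?thesis unfolding K_def by linarith
qed

lemma eval_form_at_origin:
  assumes "p \<in> forms n b d" "d > 0" "coord_support n x = {}"
  shows "eval_mpoly x p = 0"
  unfolding eval_mpoly_def
proof (intro sum.neutral ballI)
  fix m assume "m \<in> Poly_Mapping.keys p"
  then have m: "Poly_Mapping.keys m \<subseteq> {1..n}" "monomial_degree b m = d"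
    using assms(1) by (auto simp: forms_def monoms_def)
  then have "Poly_Mapping.keys m \<noteq> {}" using assms(2) by (auto simp: monomial_degree_def)
  then obtain i where i: "i \<in> Poly_Mapping.keys m" by blast
  then have "x i = 0" using assms(3) m(1) by (auto simp: coord_support_def)
  then have "eval_monomial x m = 0"
    unfolding eval_monomial_def using i by (auto simp: in_keys_iff)
  then show "Poly_Mapping.lookup p m * eval_monomial x m = 0" by simp
qed

text \<open>
  Sufficiency of the inequalities. The sequence \<open>z\<close> lists the general forms of degrees \<open>a i\<close>, the
  general forms of degree \<open>D\<close> and the variables. Windows of length \<open>n\<close> are moved from the variables
  to the first \<open>n\<close> members. The middle block is needed because a mixture of the first forms with
  some of the variables can have further common zeros, even though the inequalities hold.
\<close>

lemma regular_sequence_of_card_bounds: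
  assumes pos: "\<forall>i\<in>{1..n}. b i > 0" and a: "\<forall>i\<in>{1..n}. a i > 0"
    and bound: "\<And>I. I \<subseteq> {1..n} \<Longrightarrow>
      card I \<le> card {i\<in>{1..n}. \<exists>m\<in>monoms n b (a i). Poly_Mapping.keys m \<subseteq> I}"
  shows "\<exists>f. (\<forall>i\<in>{1..n}. f i \<in> forms n b (a i) \<and> f i \<noteq> 0) \<and> regular_sequence (mpoly_ring n) n f"
proof -
  define D where "D = (\<Prod>i\<in>{1..n}. b i)"
  have D: "D > 0" using pos by (auto simp: D_def intro!: prod_pos)
  have monomD: "\<exists>m\<in>monoms n b D. Poly_Mapping.keys m \<subseteq> I" if "I \<subseteq> {1..n}" "I \<noteq> {}" for I
  proof -
    obtain l where l: "l \<in> I" "l \<in> {1..n}" using \<open>I \<noteq> {}\<close> \<open>I \<subseteq> _\<close> by blast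
    have "b l dvd D" unfolding D_def using l by (intro dvd_prodI) auto
    then have "monomial_degree b (Poly_Mapping.single l (D div b l)) = D"
      using D by (auto simp: monomial_degree_def lookup_single dvd_div_eq_0_iff)
    then show ?thesis using l
      by (intro bexI[of _ "Poly_Mapping.single l (D div b l)"]) (auto simp: monoms_def)
  qed
  define d where "d = (\<lambda>i. if i \<le> n then a i else D)"
  obtain F where F: "\<And>i. i \<in> {1..2*n} \<Longrightarrow> F i \<in> forms n b (d i) \<and> (monoms n b (d i) \<noteq> {} \<longrightarrow> F i \<noteq> 0)"
    and few: "\<And>x. coord_support n x \<noteq> {} \<Longrightarrow>
      card {i\<in>{1..2*n}. (\<exists>m\<in>monoms n b (d i). Poly_Mapping.keys m \<subseteq> coord_support n x) \<and> eval_mpoly x (F i) = 0}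
        < card (coord_support n x)"
    using exists_general_forms[OF pos, of "{1..2*n}" d] by blast
  define z where "z = (\<lambda>i. if i \<le> 2 * n then F i else var (i - 2 * n))"
  define e where "e = (\<lambda>i. if i \<le> 2 * n then d i else b (i - 2 * n))"
  have z: "z i \<in> forms n b (e i) \<and> e i > 0" if "i \<in> {1..3*n}" for i
  proof (cases "i \<le> 2 * n")
    case True
    with that F[of i] a D show ?thesis by (auto simp: z_def e_def d_def)
  next
    case False
    with that have "i - 2 * n \<in> {1..n}" by auto
    with False forms_var[of "i - 2 * n" n b] pos show ?thesis by (auto simp: z_def e_def)
  qed
  have origin: "coord_support n x = {}"
    if s: "s \<le> 2 * n" and zero: "\<And>i. i \<in> {s+1..s+n} \<Longrightarrow> eval_mpoly x (z i) = 0" for s x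
  proof (rule ccontr)
    assume nonempty: "coord_support n x \<noteq> {}"
    define I where "I = coord_support n x"
    define K where "K = {i\<in>{1..2*n}. (\<exists>m\<in>monoms n b (d i). Poly_Mapping.keys m \<subseteq> I) \<and> eval_mpoly x (F i) = 0}"
    have I: "I \<subseteq> {1..n}" "I \<noteq> {}" using nonempty by (auto simp: I_def coord_support_def)
    have finK: "finite K" by (simp add: K_def)
    have less: "card K < card I" using few[OF nonempty] by (simp add: K_def I_def)
    have inK: "i \<in> K" if "i \<in> {s+1..s+n}" "i \<le> 2 * n" "\<exists>m\<in>monoms n b (d i). Poly_Mapping.keys m \<subseteq> I" for i
      using that zero[of i] by (auto simp: K_def z_def)
    show False
    proof (cases "s \<le> n")
      case True
      \<comment> \<open>The window omits \<open>s\<close> of the first forms and contains \<open>s\<close> forms of degree \<open>D\<close> instead.\<close>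
      define A where "A = {i\<in>{1..n}. \<exists>m\<in>monoms n b (a i). Poly_Mapping.keys m \<subseteq> I}"
      have "i \<in> K" if "i \<in> (A - {1..s}) \<union> {n+1..n+s}" for i
      proof (rule inK)
        show "i \<in> {s+1..s+n}" "i \<le> 2 * n" using that True by (auto simp: A_def)
        show "\<exists>m\<in>monoms n b (d i). Poly_Mapping.keys m \<subseteq> I"
          using that monomD[OF I] by (cases "i \<le> n") (simp_all add: A_def d_def)
      qed
      then have "card ((A - {1..s}) \<union> {n+1..n+s}) \<le> card K" by (intro card_mono finK) blast
      moreover have "card ((A - {1..s}) \<union> {n+1..n+s}) = card (A - {1..s}) + s"
        by (subst card_Un_disjoint) (auto simp: A_def)
      moreover have "card A - card {1..s} \<le> card (A - {1..s})" by (rule diff_card_le_card_Diff) simp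
      moreover have "card I \<le> card A" unfolding A_def by (rule bound[OF I(1)])
      ultimately show False using less by simp
    next
      case False
      \<comment> \<open>The window contains the first \<open>s - n\<close> variables, so that the support of the zero is no larger
        than the number of forms of degree \<open>D\<close> in it.\<close>
      have "x j = 0" if "j \<in> {1..s-n}" for j
      proof -
        have "2 * n + j \<in> {s+1..s+n}" using that s False by auto
        from zero[OF this] that show ?thesis by (simp add: z_def)
      qed
      then have "I \<subseteq> {s-n+1..n}" by (force simp: I_def coord_support_def)
      then have "card I \<le> 2 * n - s" using card_mono[of "{s-n+1..n}" I] False by simp
      moreover have "i \<in> K" if "i \<in> {s+1..2*n}" for i
        using that inK[of i] monomD[OF I] False by (auto simp: d_def)
      then have "card {s+1..2*n} \<le> card K" by (intro card_mono finK) blast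
      ultimately show False using less by simp
    qed
  qed
  \<comment> \<open>Any argument between 0 and 1 detects regularity.\<close>
  define t :: real where "t = 1 / 2"
  have t: "0 < t" "t < 1" by (simp_all add: t_def)
  have vars: "has_ci_series n b t z e {2*n+1..2*n+k}" if "k \<le> n" for k
    using that
  proof (induction k)
    case 0
    then show ?case by (simp add: has_ci_series_def Ideal_empty)
  next
    case (Suc k)
    have ins: "{2*n+1..2*n+Suc k} = insert (2*n+Suc k) {2*n+1..2*n+k}" by auto
    have "z ` {2*n+1..2*n+k} = var ` {1..k}"
    proof -
      have shift: "{2*n+1..2*n+k} = (\<lambda>j. 2*n+j) ` {1..k}" by simp
      show ?thesis unfolding shift image_image by (intro image_cong) (auto simp: z_def)
    qed
    moreover have "z (2*n+Suc k) = var (Suc k)" by (simp add: z_def)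
    moreover have "var (Suc k) \<in> forms n b (e (2*n+Suc k))"
      using z[of "2*n+Suc k"] Suc.prems by (simp add: z_def)
    moreover have "u \<in> Ideal n (var ` {1..k})"
      if "u \<in> polys n" "u * var (Suc k) \<in> Ideal n (var ` {1..k})" for u
      using Suc.prems by (intro var_nonzerodivisor[OF _ _ _ that]) auto
    ultimately show ?case
      unfolding ins using Suc z by (subst has_ci_series_insert_iff[OF pos t]) auto
  qed
  have windows: "k \<le> 2 * n \<Longrightarrow> has_ci_series n b t z e {2*n-k+1..2*n-k+n}" for k
  proof (induction k)
    case 0
    then show ?case using vars[of n] by simp
  next
    case (Suc k)
    define s where "s = 2 * n - Suc k"
    \<comment> \<open>The window that starts at \<open>s + 1\<close> arises from the one that starts at \<open>s + 2\<close> by exchanging the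
      member \<open>s + n + 1\<close> for the member \<open>s + 1\<close>.\<close>
    define L where "L = {s+2..s+n}"
    have s: "2 * n - k = s + 1" "s + 1 \<le> 2 * n" using Suc.prems by (auto simp: s_def)
    then have "n \<ge> 1" by simp
    have W: "{s+1+1..s+1+n} = insert (s+n+1) L" "{s+1..s+n} = insert (s+1) L"
      using \<open>n \<ge> 1\<close> by (auto simp: L_def)
    have L: "L \<subseteq> {1..3*n}" "s+n+1 \<in> {1..3*n}" "s+1 \<in> {1..3*n}" using s by (auto simp: L_def)
    have zL: "z i \<in> forms n b (e i)" if "i \<in> insert (s+n+1) (insert (s+1) L)" for i
      using that z L by blast
    have gr: "graded_ideal n b (Ideal n (z ` insert (s+1) L))"
      using zL by (intro graded_ideal_Ideal[where d = e]) (auto simp: L_def)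
    have "eval_mpoly x (z (s+n+1)) = 0"
      if "\<And>p. p \<in> Ideal n (z ` insert (s+1) L) \<Longrightarrow> eval_mpoly x p = 0" for x
    proof (rule eval_form_at_origin)
      show "z (s+n+1) \<in> forms n b (e (s+n+1))" "e (s+n+1) > 0" using z[OF L(2)] by auto
      have polys: "z ` insert (s+1) L \<subseteq> polys n" using zL forms_subset_polys by blast
      have "eval_mpoly x (z i) = 0" if "i \<in> {s+1..s+n}" for i
        using that W(2) Ideal_self[OF polys] \<open>\<And>p. p \<in> _ \<Longrightarrow> eval_mpoly x p = 0\<close> by blast
      then show "coord_support n x = {}" using s(2) by (intro origin[of s]) auto
    qed
    then obtain k' where pow: "z (s+n+1) ^ k' \<in> Ideal n (z ` insert (s+1) L)"
      using power_in_graded_ideal[OF gr] z[OF L(2)] by blast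
    have "finite L" "s+n+1 \<notin> L" "s+1 \<notin> L" by (auto simp: L_def)
    moreover have "has_ci_series n b t z e (insert (s+n+1) L)" using Suc s W(1) by simp
    moreover have "e (s+n+1) > 0" "e (s+1) > 0" using z[OF L(2)] z[OF L(3)] by auto
    ultimately have "has_ci_series n b t z e (insert (s+1) L)"
      using has_ci_series_exchange[OF pos t _ _ _ _ _ zL _ pow] by blast
    then show ?case using W(2) by (simp add: s_def)
  qed
  have ci: "has_ci_series n b t z e {1..n}" using windows[of "2*n"] by simp
  have zf: "z i \<in> forms n b (a i) \<and> e i = a i" if "i \<in> {1..n}" for i
    using that F[of i] by (auto simp: z_def e_def d_def)
  have "regular_sequence (mpoly_ring n) n z"
    using z by (intro regular_sequence_of_ci_series[OF pos t _ ci]) auto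
  moreover have "z i \<noteq> 0" if i: "i \<in> {1..n}" for i
  proof -
    have "card {1..n} \<le> card {i\<in>{1..n}. \<exists>m\<in>monoms n b (a i). Poly_Mapping.keys m \<subseteq> {1..n}}"
      by (rule bound) simp
    then have "{i\<in>{1..n}. \<exists>m\<in>monoms n b (a i). Poly_Mapping.keys m \<subseteq> {1..n}} = {1..n}"
      by (intro card_seteq) auto
    then have "monoms n b (a i) \<noteq> {}" using i by blast
    then show ?thesis using F[of i] i by (auto simp: z_def d_def)
  qed
  ultimately show ?thesis using zf by blast
qed

theorem proposition1p4:
  fixes n :: nat and a b :: "nat \<Rightarrow> nat" and A :: "nat multiset"
  assumes "n \<ge> 1"
    and "\<forall>i\<in>{1..n}. a i > 0"
    and "\<forall>i\<in>{1..n}. b i > 0"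
    and "A = indexed_mset a {1..n}"
  shows "(\<exists>f. (\<forall>i\<in>{1..n}. homogeneous_of_degree n b (a i) (f i)) \<and>
              regular_sequence (mpoly_ring n) n f)
     \<longleftrightarrow> (\<forall>I\<subseteq>{1..n}.
           size (mset_inter_set A (semigroup_gen (set_mset (indexed_mset b I)))) \<ge> card I)"
proof -
  have size: "size (mset_inter_set A (semigroup_gen (set_mset (indexed_mset b I)))) =
      card {i\<in>{1..n}. \<exists>m\<in>monoms n b (a i). Poly_Mapping.keys m \<subseteq> I}" if "I \<subseteq> {1..n}" for I
    by (simp add: assms(4) size_mset_inter_set semigroup_gen_iff_monomial[OF that])
  show ?thesis
  proof
    assume "\<exists>f. (\<forall>i\<in>{1..n}. homogeneous_of_degree n b (a i) (f i)) \<and>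
      regular_sequence (mpoly_ring n) n f"
    then obtain f where f: "\<And>i. i \<in> {1..n} \<Longrightarrow> f i \<in> forms n b (a i) \<and> a i > 0"
      and reg: "regular_sequence (mpoly_ring n) n f"
      using assms(2) unfolding homogeneous_of_degree_iff by blast
    show "\<forall>I\<subseteq>{1..n}. size (mset_inter_set A (semigroup_gen (set_mset (indexed_mset b I)))) \<ge> card I"
      using card_bound_of_regular_sequence[OF assms(3) f reg] size by simp
  next
    assume bound: "\<forall>I\<subseteq>{1..n}. size (mset_inter_set A (semigroup_gen (set_mset (indexed_mset b I)))) \<ge> card I"
    have "\<exists>f. (\<forall>i\<in>{1..n}. f i \<in> forms n b (a i) \<and> f i \<noteq> 0) \<and> regular_sequence (mpoly_ring n) n f"
      using bound size by (intro regular_sequence_of_card_bounds[OF assms(3,2)]) auto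
    then show "\<exists>f. (\<forall>i\<in>{1..n}. homogeneous_of_degree n b (a i) (f i)) \<and>
        regular_sequence (mpoly_ring n) n f"
      by (simp add: homogeneous_of_degree_iff)
  qed
qed

end
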